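(* Let $\{b(n)\}_{n\ge1}$ be a real sequence and let $\{\tilde b_\omega(n)\}_{n\ge1}$ be a sequence of independent real-valued random variables with zero mean on a probability space $(\Omega,\mathcal F,P)$. For $E\in\Lambda_0$ (the set $\Lambda_0$ being defined from the potential $\{b(n)\}$), $\tilde\eta>0$ and $n\ge1$ let $$r^E_{\tilde\eta}(n)=|\varphi^E_{1,\theta(E)}(n)|^4\,n^{2\tilde\eta}+|\varphi^E_{2,\theta(E)}(n)|^4 ,$$ where the $\varphi$'s are the solutions for the potential $\{b(n)\}$, and let $$\Lambda=\Big\{E\in\Lambda_0\ \Big|\ \sum_{n=1}^\infty r^E_{\tilde\eta}(n)\,\langle\tilde b_\omega(n)^2\rangle<\infty\ \text{ for some }\tilde\eta>\eta(E)\Big\}.$$ Then, for any $0<\alpha<1$ and any fixed measure $\nu$ on $\mathbb R$, for $P$-a.e. $\omega$, $$\Lambda\cap\Sigma_{\alpha{\rm c}}(\mathbf 1,\{b(n)\})\subseteq\Sigma_{\alpha{\rm c}}(\mathbf 1,\{b(n)+\tilde b_\omega(n)\}),$$ $$\Lambda\cap\Sigma_{\alpha{\rm s}}(\mathbf 1,\{b(n)\})\subseteq\Sigma_{\alpha{\rm s}}(\mathbf 1,\{b(n)+\tilde b_\omega(n)\}),$$ where each inclusion is up to a set of $\nu$-measure zero.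
   Context: $\langle f_\omega\rangle=\int_\Omega f_\omega\,dP(\omega)$. A measure on $\mathbb R$ means a $\sigma$-finite Borel measure. $\mathbf 1$ denotes the constant sequence of off-diagonal entries equal to $1$, indicating the discrete Schrödinger case. The following objects are defined for any real potential $\{b(n)\}_{n\ge1}$ (and are applied to both $\{b(n)\}$ and $\{b(n)+\tilde b_\omega(n)\}$). Solutions. For $E,\theta\in\mathbb R$, $\varphi^E_{1,\theta}$ is the solution of $\varphi(n+1)+\varphi(n-1)+b(n)\varphi(n)=E\varphi(n)$, $n\ge1$, with $\varphi^E_{1,\theta}(0)=-\sin\theta$, $\varphi^E_{1,\theta}(1)=\cos\theta$, and $\varphi^E_{2,\theta}=\varphi^E_{1,\theta-\pi/2}$. For $|\theta|<\pi/2$, $\varphi^E_{1,\theta}$ restricted to $n\ge1$ is the generalized eigenvector at energy $E$ of the matrix $H_\theta$ on $\ell^2(\mathbb Z_+)$ that has off-diagonal entries $1$ and diagonal entries $b(1)-\tan\theta,b(2),b(3),\dots$; $\mu_\theta$ is the spectral measure of $\delta_1$ for $H_\theta$. For $f:\mathbb Z_+\to\mathbb C$ and $L>0$, $\|f\|_L^2=\sum_{n=1}^{\lfloor L\rfloor}|f(n)|^2+(L-\lfloor L\rfloor)|f(\lfloor L\rfloor+1)|^2$. Subordinacy. For $\theta\in[-\pi/2,\pi/2)$, $\varphi^E_{1,\theta}$ is called subordinate if $\lim_{L\to\infty}\|\varphi^E_{1,\theta}\|_L/\|\varphi^E_{2,\theta}\|_L=0$. For given $E$ there is at most one such $\theta\in[-\pi/2,\pi/2)$;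 if it exists it is denoted $\theta(E)$. Set $$\Sigma_{\rm pp}=\{E:\theta(E)\text{ exists and }\varphi^E_{1,\theta(E)}\in\ell^2\},\qquad \Sigma_{\rm sc}=\{E:\theta(E)\text{ exists and }\varphi^E_{1,\theta(E)}\notin\ell^2\}.$$ Hausdorff-dimensional supports. For $0<\alpha<1$, $\Sigma_{\alpha{\rm s}}=\Sigma_{\alpha{\rm s}}(\mathbf 1,\{b(n)\})$ is the union of $\Sigma_{\rm pp}$ and the set of $E\in\Sigma_{\rm sc}$ with $$\liminf_{L\to\infty}\frac{\|\varphi^E_{1,\theta(E)}\|_L}{\|\varphi^E_{2,\theta(E)}\|_L^{\alpha/(2-\alpha)}}=0,$$ and $\Sigma_{\alpha{\rm c}}=\mathbb R\setminus\Sigma_{\alpha{\rm s}}$. (For every $\theta$, $\mu_\theta(\Sigma_{\alpha{\rm c}}\cap\cdot)$ and $\mu_\theta(\Sigma_{\alpha{\rm s}}\cap\cdot)$ are the parts of $\mu_\theta$ that are respectively continuous and singular with respect to the $\alpha$-dimensional Hausdorff measure.) Exponents. For $E\in\Sigma_{\rm sc}$, $$\beta(E)=\liminf_{L\to\infty}\frac{\ln\|\varphi^E_{1,\theta(E)}\|_L}{\ln\|\varphi^E_{2,\theta(E)}\|_L},$$ and if $\beta(E)>0$, $\eta(E)=\frac{1-\beta(E)}{\beta(E)}$. An energy $E$ is regular if there is some $\theta$ such that for all $\varepsilon>0$ there is a constant $C_\varepsilon$ with $\|\varphi^E_{1,\theta}\|_L<C_\varepsilon L^{\frac12+\varepsilon}$.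 $\Lambda_0=\{E\in\Sigma_{\rm sc}: E\text{ is regular and }\beta(E)>0\}$. *)

theory Defs
  imports "HOL-Probability.Probability"
begin

text \<open>
  A potential is a sequence \<open>b :: nat \<Rightarrow> real\<close> of which only the values at indices \<open>n \<ge> 1\<close>
  matter. A solution is a function on all of \<open>nat\<close>; its value at \<open>0\<close> carries the boundary
  condition and never enters the norms or \<open>\<ell>\<^sup>2\<close> conditions below.
\<close>

fun phi1 :: "(nat \<Rightarrow> real) \<Rightarrow> real \<Rightarrow> real \<Rightarrow> nat \<Rightarrow> real" where
  "phi1 b E \<theta> 0 = - sin \<theta>"
| "phi1 b E \<theta> (Suc 0) = cos \<theta>"
| "phi1 b E \<theta> (Suc (Suc n)) = (E - b (Suc n)) * phi1 b E \<theta> (Suc n) - phi1 b E \<theta> n"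

definition phi2 :: "(nat \<Rightarrow> real) \<Rightarrow> real \<Rightarrow> real \<Rightarrow> nat \<Rightarrow> real" where
  "phi2 b E \<theta> = phi1 b E (\<theta> - pi / 2)"

definition is_solution :: "(nat \<Rightarrow> real) \<Rightarrow> real \<Rightarrow> (nat \<Rightarrow> real) \<Rightarrow> bool" where
  "is_solution b E f \<longleftrightarrow> (\<forall>n\<ge>1. f (n + 1) + f (n - 1) + b n * f n = E * f n)"

lemma phi1_unique_solution:
  "is_solution b E f \<and> f 0 = - sin \<theta> \<and> f 1 = cos \<theta> \<longleftrightarrow> f = phi1 b E \<theta>"
proof
  assume *: "is_solution b E f \<and> f 0 = - sin \<theta> \<and> f 1 = cos \<theta>"
  have step: "f (Suc (Suc n)) = (E - b (Suc n)) * f (Suc n) - f n" for n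
    using *[unfolded is_solution_def, THEN conjunct1, rule_format, of "Suc n"]
    by (simp add: algebra_simps)
  have "f n = phi1 b E \<theta> n" for n
    by (induction n rule: induct_nat_012) (use * step in auto)
  then show "f = phi1 b E \<theta>" by auto
next
  assume f: "f = phi1 b E \<theta>"
  have "f (n + 1) + f (n - 1) + b n * f n = E * f n" if "n \<ge> 1" for n
    using that unfolding f by (cases n) (auto simp: algebra_simps)
  then show "is_solution b E f \<and> f 0 = - sin \<theta> \<and> f 1 = cos \<theta>"
    unfolding is_solution_def using f by auto
qed

definition norm_upto :: "(nat \<Rightarrow> 'a::real_normed_vector) \<Rightarrow> real \<Rightarrow> real" where
  "norm_upto f L = sqrt ((\<Sum>n=1..nat \<lfloor>L\<rfloor>. (norm (f n))\<^sup>2)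
      + (L - of_int \<lfloor>L\<rfloor>) * (norm (f (nat \<lfloor>L\<rfloor> + 1)))\<^sup>2)"

definition in_l2 :: "(nat \<Rightarrow> real) \<Rightarrow> bool" where
  "in_l2 f \<longleftrightarrow> summable (\<lambda>n. (f (Suc n))\<^sup>2)"

definition subordinate :: "(nat \<Rightarrow> real) \<Rightarrow> real \<Rightarrow> real \<Rightarrow> bool" where
  "subordinate b E \<theta> \<longleftrightarrow>
     ((\<lambda>L. norm_upto (phi1 b E \<theta>) L / norm_upto (phi2 b E \<theta>) L) \<longlongrightarrow> 0) at_top"

definition has_theta :: "(nat \<Rightarrow> real) \<Rightarrow> real \<Rightarrow> bool" where
  "has_theta b E \<longleftrightarrow> (\<exists>\<theta>\<in>{- pi / 2..<pi / 2}. subordinate b E \<theta>)"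

text \<open>There is at most one such angle, so the description is proper whenever \<open>has_theta b E\<close>.\<close>

definition theta :: "(nat \<Rightarrow> real) \<Rightarrow> real \<Rightarrow> real" where
  "theta b E = (THE \<theta>. \<theta> \<in> {- pi / 2..<pi / 2} \<and> subordinate b E \<theta>)"

definition Sigma_pp :: "(nat \<Rightarrow> real) \<Rightarrow> real set" where
  "Sigma_pp b = {E. has_theta b E \<and> in_l2 (phi1 b E (theta b E))}"

definition Sigma_sc :: "(nat \<Rightarrow> real) \<Rightarrow> real set" where
  "Sigma_sc b = {E. has_theta b E \<and> \<not> in_l2 (phi1 b E (theta b E))}"

definition Sigma_alpha_s :: "real \<Rightarrow> (nat \<Rightarrow> real) \<Rightarrow> real set" where
  "Sigma_alpha_s \<alpha> b = Sigma_pp b \<union>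
     {E \<in> Sigma_sc b.
        Liminf at_top (\<lambda>L. ereal (norm_upto (phi1 b E (theta b E)) L
            / norm_upto (phi2 b E (theta b E)) L powr (\<alpha> / (2 - \<alpha>)))) = 0}"

definition Sigma_alpha_c :: "real \<Rightarrow> (nat \<Rightarrow> real) \<Rightarrow> real set" where
  "Sigma_alpha_c \<alpha> b = UNIV - Sigma_alpha_s \<alpha> b"

text \<open>
  For \<open>E \<in> Sigma_sc b\<close> both norms tend to infinity and the first is eventually the smaller one,
  so the lower limit lies in \<open>[0, 1]\<close> and passing from \<open>ereal\<close> to \<open>real\<close> loses nothing.
\<close>

definition beta :: "(nat \<Rightarrow> real) \<Rightarrow> real \<Rightarrow> real" where
  "beta b E = real_of_ereal (Liminf at_top (\<lambda>L.
     ereal (ln (norm_upto (phi1 b E (theta b E)) L) / ln (norm_upto (phi2 b E (theta b E)) L))))"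

definition eta :: "(nat \<Rightarrow> real) \<Rightarrow> real \<Rightarrow> real" where
  "eta b E = (1 - beta b E) / beta b E"

text \<open>
  Regularity is a growth condition at infinity, hence the restriction to \<open>L \<ge> 1\<close>: as \<open>L\<close> tends
  to \<open>0\<close> the norm behaves like \<open>L powr (1/2)\<close>, which no multiple of \<open>L powr (1/2 + \<epsilon>)\<close> bounds
  unless the solution vanishes at \<open>1\<close>.
\<close>

definition regular_energy :: "(nat \<Rightarrow> real) \<Rightarrow> real \<Rightarrow> bool" where
  "regular_energy b E \<longleftrightarrow>
     (\<exists>\<theta>. \<forall>\<epsilon>>0. \<exists>C. \<forall>L\<ge>1. norm_upto (phi1 b E \<theta>) L < C * L powr (1 / 2 + \<epsilon>))"

definition Lambda0 :: "(nat \<Rightarrow> real) \<Rightarrow> real set" where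
  "Lambda0 b = {E \<in> Sigma_sc b. regular_energy b E \<and> beta b E > 0}"

definition r_weight :: "(nat \<Rightarrow> real) \<Rightarrow> real \<Rightarrow> real \<Rightarrow> nat \<Rightarrow> real" where
  "r_weight b E \<eta>' n = \<bar>phi1 b E (theta b E) n\<bar> ^ 4 * real n powr (2 * \<eta>')
      + \<bar>phi2 b E (theta b E) n\<bar> ^ 4"

text \<open>
  The second moments are not assumed finite, so they and the series are taken in \<open>ennreal\<close>.
  The weights are strictly positive for \<open>n \<ge> 1\<close> (the two solutions have no common zero), so the
  convention \<open>0 * \<infinity> = 0\<close> plays no role. The series starts at \<open>n = 1\<close>, hence \<open>Suc n\<close>.
\<close>

definition Lambda_set ::
  "'w measure \<Rightarrow> (nat \<Rightarrow> real) \<Rightarrow> (nat \<Rightarrow> 'w \<Rightarrow> real) \<Rightarrow> real set" where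
  "Lambda_set P b bt = {E \<in> Lambda0 b. \<exists>\<eta>'>0. \<eta>' > eta b E \<and>
     (\<Sum>n. ennreal (r_weight b E \<eta>' (Suc n)) * (\<integral>\<^sup>+\<omega>. ennreal ((bt (Suc n) \<omega>)\<^sup>2) \<partial>P)) < \<infinity>}"

end

theory Submission imports Defs "HOL-Library.Landau_Symbols" begin

text \<open>
  Fix an energy \<open>E\<close> in \<open>\<Lambda>\<close>, let \<open>f\<close> be the subordinate solution and \<open>g\<close> the complementary solution of
  the unperturbed equation, normalised so that their discrete Wronskian is \<open>1\<close>, and let \<open>v\<close> be the
  perturbation. A solution \<open>u\<close> of the perturbed equation is written as \<open>a\<^sub>n f + c\<^sub>n g\<close>, where the
  coordinates \<open>a\<^sub>n\<close> and \<open>c\<^sub>n\<close> are the Wronskians of \<open>u\<close> with \<open>g\<close> and \<open>f\<close>. Variation of parameters gives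
  \<open>a\<^sub>n\<^sub>+\<^sub>1 = a\<^sub>n - v g u\<close> and \<open>c\<^sub>n\<^sub>+\<^sub>1 = c\<^sub>n + v f u\<close>, with \<open>v\<close>, \<open>f\<close>, \<open>g\<close>, \<open>u\<close> evaluated at \<open>n + 1\<close>. As
  \<open>u (n + 1)\<close> is a function of \<open>v 1, \<dots>, v n\<close> only, the increments are orthogonal to the past.

  Probability. The second moment of \<open>(a\<^sub>n, c\<^sub>n)\<close> grows at each step at most by the factor
  \<open>1 + \<langle>v\<^sup>2\<rangle> (f\<^sup>2 + g\<^sup>2)\<^sup>2\<close>, hence stays bounded by the summability that defines \<open>\<Lambda>\<close>
  (\<open>perturbed_solution_second_moment\<close>). A Kolmogorov inequality for martingale transforms of independent
  centered variables then shows that almost surely \<open>a\<^sub>n\<close> converges and so does the series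
  \<open>\<Sum> n\<^bsup>q/2\<^esup> v f u\<close>, for every positive rational \<open>q > \<eta>(E)\<close> below the exponent \<open>\<eta>'\<close> of \<open>\<Lambda>\<close>
  (\<open>transform_converges\<close>, \<open>AE_asymptotically_free\<close>). By Abel summation \<open>c\<^sub>n\<close> converges as well, and its
  distance to the limit is \<open>o(n\<^bsup>-q/2\<^esup>)\<close>.

  Determinism. The coordinates of two independent perturbed solutions form matrices of determinant
  \<open>1\<close>, so the limit matrix is invertible and there are perturbed solutions \<open>u\<close> and \<open>w\<close> with limit
  coordinates \<open>(1, 0)\<close> and \<open>(0, 1)\<close>. The norms of \<open>w\<close> and \<open>g\<close> are comparable because \<open>g\<close> dominates. For
  \<open>u\<close> one must know that \<open>c\<^sub>n g\<close> is negligible against \<open>f\<close>. The definition of \<open>\<beta>\<close> bounds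
  \<open>\<parallel>g\<parallel>\<^sub>L\<close> by \<open>\<parallel>f\<parallel>\<^sub>L \<parallel>f\<parallel>\<^sub>L\<^bsup>q'\<^esup>\<close> for \<open>q'\<close> slightly above \<open>\<eta>(E)\<close>, and regularity bounds \<open>\<parallel>f\<parallel>\<^sub>L\<close> by
  \<open>L\<^bsup>1/2 + \<epsilon>\<^esup>\<close>. Together \<open>\<parallel>g\<parallel>\<^sub>L\<close> is at most \<open>L\<^bsup>t\<^esup> \<parallel>f\<parallel>\<^sub>L\<close> for some \<open>t < q/2\<close>, and summation by parts
  turns the decay \<open>n\<^bsup>-q/2\<^esup>\<close> of \<open>c\<^sub>n\<close> into what is required (\<open>Lambda0_growth\<close>,
  \<open>norm_upto_powr_weight_bigo\<close>). So the perturbed operator has a subordinate solution at \<open>E\<close>, and both norms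
  in the definition of \<open>\<Sigma>\<^sub>\<alpha>\<^sub>s\<close> change at most by bounded factors; membership in \<open>\<Sigma>\<^sub>\<alpha>\<^sub>s\<close>, and so in
  its complement, is preserved (\<open>asymptotically_free_transfer\<close>).

  Null sets. All this holds for almost every \<open>\<omega>\<close> at a fixed \<open>E\<close>. To get almost every \<open>E\<close> at almost
  every \<open>\<omega>\<close>, Tonelli's theorem is applied to the event that the two limits above exist. It is jointly
  measurable in \<open>(E, \<omega>)\<close> once the angle \<open>\<theta>(E)\<close> is: that angle is recovered from limits of Gram
  matrices of solutions with fixed initial data (\<open>limit_angle_eq_theta\<close>, \<open>AE_swap_of_measurable\<close>).
\<close>

section \<open>Truncated norms\<close>

text \<open>
  The interpolation in \<open>L\<close> is a weight on the last entry. As a Euclidean norm of finitely many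
  weighted entries, the truncated norm inherits the triangle inequality at every real \<open>L\<close>.
\<close>
lemma norm_upto_L2_set:
  fixes f :: "nat \<Rightarrow> real"
  assumes "0 \<le> L"
  shows "norm_upto f L = L2_set (\<lambda>n. (if n \<le> nat \<lfloor>L\<rfloor> then 1 else sqrt (frac L)) * f n) {1..Suc (nat \<lfloor>L\<rfloor>)}"
  unfolding norm_upto_def L2_set_def
  by (simp add: power_mult_distrib frac_def)

text \<open>
  The squared norm is linear in \<open>L\<close> between integers, so that comparisons of squared norms need only
  be made at integers.
\<close>
lemma norm_upto_sq:
  fixes f :: "nat \<Rightarrow> real"
  assumes "0 \<le> L"
  shows "(norm_upto f L)\<^sup>2 = (1 - frac L) * (\<Sum>n=1..nat \<lfloor>L\<rfloor>. (f n)\<^sup>2)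
     + frac L * (\<Sum>n=1..Suc (nat \<lfloor>L\<rfloor>). (f n)\<^sup>2)"
proof -
  have "0 \<le> (\<Sum>n=1..nat \<lfloor>L\<rfloor>. (f n)\<^sup>2) + frac L * (f (Suc (nat \<lfloor>L\<rfloor>)))\<^sup>2"
    by (intro add_nonneg_nonneg sum_nonneg mult_nonneg_nonneg) auto
  then show ?thesis
    unfolding norm_upto_def by (simp add: algebra_simps frac_def)
qed

lemma norm_upto_of_nat:
  fixes f :: "nat \<Rightarrow> real"
  shows "norm_upto f (real N) = sqrt (\<Sum>n=1..N. (f n)\<^sup>2)"
  by (simp add: norm_upto_def)

lemma norm_upto_nonneg: "0 \<le> L \<Longrightarrow> 0 \<le> norm_upto (f :: nat \<Rightarrow> real) L"
  by (simp add: norm_upto_L2_set)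

lemma norm_upto_add:
  fixes f g :: "nat \<Rightarrow> real"
  assumes "0 \<le> L"
  shows "norm_upto (\<lambda>n. f n + g n) L \<le> norm_upto f L + norm_upto g L"
  using assms by (simp only: norm_upto_L2_set distrib_left L2_set_triangle_ineq)

lemma norm_upto_mono:
  fixes f g :: "nat \<Rightarrow> real"
  assumes "0 \<le> L" "\<And>n. \<bar>f n\<bar> \<le> \<bar>g n\<bar>"
  shows "norm_upto f L \<le> norm_upto g L"
proof -
  have "(f n)\<^sup>2 \<le> (g n)\<^sup>2" for n
    using assms(2) by (simp add: abs_le_square_iff)
  then have "(norm_upto f L)\<^sup>2 \<le> (norm_upto g L)\<^sup>2"
    unfolding norm_upto_sq[OF assms(1)]
    by (intro add_mono mult_left_mono sum_mono) (auto intro: less_imp_le simp: frac_lt_1)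
  then show ?thesis
    using norm_upto_nonneg[OF assms(1)] by (auto simp: power2_le_iff_abs_le)
qed

lemma norm_upto_cmult:
  fixes f :: "nat \<Rightarrow> real"
  assumes "0 \<le> L"
  shows "norm_upto (\<lambda>n. c * f n) L = \<bar>c\<bar> * norm_upto f L"
proof -
  have "(norm_upto (\<lambda>n. c * f n) L)\<^sup>2 = (\<bar>c\<bar> * norm_upto f L)\<^sup>2"
    by (simp add: norm_upto_sq[OF assms] power_mult_distrib flip: sum_distrib_left)
       (simp add: algebra_simps)
  then show ?thesis
    using norm_upto_nonneg[OF assms] by (smt (verit) abs_ge_zero mult_nonneg_nonneg power2_eq_iff_nonneg)
qed

lemma norm_upto_le_from_sums:
  fixes f g :: "nat \<Rightarrow> real"
  assumes le: "\<And>N. N \<ge> N0 \<Longrightarrow> (\<Sum>n=1..N. (f n)\<^sup>2) \<le> K\<^sup>2 * (\<Sum>n=1..N. (g n)\<^sup>2)"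
    and "0 \<le> K" "real N0 \<le> L"
  shows "norm_upto f L \<le> K * norm_upto g L"
proof -
  have L: "0 \<le> L" and N: "N0 \<le> nat \<lfloor>L\<rfloor>"
    using \<open>real N0 \<le> L\<close> by linarith+
  have "(norm_upto f L)\<^sup>2 \<le> (1 - frac L) * (K\<^sup>2 * (\<Sum>n=1..nat \<lfloor>L\<rfloor>. (g n)\<^sup>2))
     + frac L * (K\<^sup>2 * (\<Sum>n=1..Suc (nat \<lfloor>L\<rfloor>). (g n)\<^sup>2))"
    unfolding norm_upto_sq[OF L] using N
    by (intro add_mono mult_left_mono le) (auto intro: less_imp_le simp: frac_lt_1)
  also have "\<dots> = (K * norm_upto g L)\<^sup>2"
    by (simp add: norm_upto_sq[OF L] algebra_simps)
  finally show ?thesis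
    using norm_upto_nonneg[OF L] \<open>0 \<le> K\<close> by (meson mult_nonneg_nonneg power2_le_imp_le)
qed

lemma norm_upto_ge_nat:
  fixes f :: "nat \<Rightarrow> real"
  assumes "real N \<le> L"
  shows "norm_upto f (real N) \<le> norm_upto f L"
proof -
  have L: "0 \<le> L" and N: "N \<le> nat \<lfloor>L\<rfloor>" using assms by linarith+
  have S: "(\<Sum>n=1..N. (f n)\<^sup>2) \<le> (\<Sum>n=1..m. (f n)\<^sup>2)" if "N \<le> m" for m
    using that by (intro sum_mono2) auto
  have "(norm_upto f (real N))\<^sup>2 = (1 - frac L) * (\<Sum>n=1..N. (f n)\<^sup>2) + frac L * (\<Sum>n=1..N. (f n)\<^sup>2)"
    by (simp add: norm_upto_of_nat sum_nonneg algebra_simps)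
  also have "\<dots> \<le> (norm_upto f L)\<^sup>2"
    unfolding norm_upto_sq[OF L] using N
    by (intro add_mono mult_left_mono S) (auto intro: less_imp_le simp: frac_lt_1)
  finally show ?thesis
    using norm_upto_nonneg[OF L] by (meson power2_le_imp_le)
qed

lemma eventually_norm_upto_nonneg:
  "\<forall>\<^sub>F L in at_top. 0 \<le> norm_upto (f :: nat \<Rightarrow> real) L"
  using eventually_ge_at_top[of 0] by eventually_elim (rule norm_upto_nonneg)

lemma not_in_l2_iff: "\<not> in_l2 f \<longleftrightarrow> filterlim (norm_upto f) at_top at_top"
proof
  assume ns: "\<not> in_l2 f"
  show "filterlim (norm_upto f) at_top at_top"
    unfolding filterlim_at_top
  proof
    fix Z
    have "\<exists>N. (\<Sum>i<N. (f (Suc i))\<^sup>2) > Z\<^sup>2"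
    proof (rule ccontr)
      assume "\<nexists>N. (\<Sum>i<N. (f (Suc i))\<^sup>2) > Z\<^sup>2"
      then have "summable (\<lambda>i. (f (Suc i))\<^sup>2)"
        by (intro summableI_nonneg_bounded[where x = "Z\<^sup>2"]) (auto simp: not_less)
      then show False using ns by (simp add: in_l2_def)
    qed
    then obtain N where "(\<Sum>i<N. (f (Suc i))\<^sup>2) > Z\<^sup>2" by blast
    then have "Z \<le> norm_upto f (real N)"
      unfolding norm_upto_of_nat by (intro real_le_rsqrt) (simp add: sum.atLeast1_atMost_eq)
    then have "Z \<le> norm_upto f L" if "real N \<le> L" for L
      using norm_upto_ge_nat[OF that, of f] by linarith
    then show "\<forall>\<^sub>F L in at_top. Z \<le> norm_upto f L"
      by (rule eventually_mono[OF eventually_ge_at_top[of "real N"]])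
  qed
next
  assume lim: "filterlim (norm_upto f) at_top at_top"
  show "\<not> in_l2 f"
  proof
    assume "in_l2 f"
    then have sm: "summable (\<lambda>i. (f (Suc i))\<^sup>2)" by (simp add: in_l2_def)
    have "norm_upto f (real N) \<le> sqrt (\<Sum>i. (f (Suc i))\<^sup>2)" for N
      unfolding norm_upto_of_nat using sum_le_suminf[OF sm, of "{..<N}"]
      by (simp add: sum.atLeast1_atMost_eq)
    moreover have "filterlim (\<lambda>N. norm_upto f (real N)) at_top sequentially"
      by (rule filterlim_compose[OF lim filterlim_real_sequentially])
    then have "\<forall>\<^sub>F N in sequentially. norm_upto f (real N) \<ge> sqrt (\<Sum>i. (f (Suc i))\<^sup>2) + 1"
      unfolding filterlim_at_top by blast
    then obtain N where "norm_upto f (real N) \<ge> sqrt (\<Sum>i. (f (Suc i))\<^sup>2) + 1"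
      by (auto simp: eventually_sequentially)
    ultimately show False by (smt (verit))
  qed
qed

lemma norm_upto_add_smallo:
  assumes "norm_upto f \<in> o(norm_upto h)" "norm_upto g \<in> o(norm_upto h)"
  shows "norm_upto (\<lambda>n. f n + g n :: real) \<in> o(norm_upto h)"
proof (rule landau_o.small_big_trans[OF landau_o.big_small_trans])
  show "(\<lambda>L. norm_upto f L + norm_upto g L) \<in> o(norm_upto h)"
    by (rule sum_in_smallo) fact+
  show "norm_upto (\<lambda>n. f n + g n) \<in> O(\<lambda>L. norm_upto f L + norm_upto g L)"
    by (intro landau_o.big_mono eventually_mono[OF eventually_ge_at_top[of 0]])
       (simp add: norm_upto_nonneg norm_upto_add)
qed auto

text \<open>
  A factor that tends to \<open>0\<close> makes a sequence negligible: beyond some index it is small, and the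
  finitely many entries before contribute a bounded amount, which is dominated as \<open>\<parallel>f\<parallel>\<^sub>L\<close> diverges.
\<close>
lemma norm_upto_vanishing_factor:
  fixes d :: "nat \<Rightarrow> real"
  assumes d: "d \<longlonglongrightarrow> 0"
    and f: "filterlim (norm_upto f) at_top at_top"
    and h: "norm_upto h \<in> O(norm_upto f)"
  shows "norm_upto (\<lambda>n. d n * h n) \<in> o(norm_upto (f :: nat \<Rightarrow> real))"
proof (rule landau_o.smallI)
  fix e :: real assume e: "e > 0"
  obtain K where K: "K > 0" "\<forall>\<^sub>F L in at_top. norm (norm_upto h L) \<le> K * norm (norm_upto f L)"
    using h by (elim landau_o.bigE) 
  define \<delta> where "\<delta> = e / (2 * K)"
  have \<delta>: "\<delta> > 0" "\<delta> * K = e / 2" using e K by (auto simp: \<delta>_def)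
  obtain M where M: "\<And>n. n \<ge> M \<Longrightarrow> \<bar>d n\<bar> \<le> \<delta>"
    using LIMSEQ_D[OF d \<delta>(1)] by (auto intro: less_imp_le)
  define p where "p = (\<lambda>n. if n < M then d n * h n else 0)"
  define B where "B = (\<Sum>n=1..M. (p n)\<^sup>2)"
  have S: "(\<Sum>n=1..N. (p n)\<^sup>2) \<le> B" for N
  proof -
    have "(\<Sum>n=1..N. (p n)\<^sup>2) \<le> (\<Sum>n=1..max N M. (p n)\<^sup>2)"
      by (intro sum_mono2) auto
    also have "\<dots> = B"
      unfolding B_def by (intro sum.mono_neutral_right) (auto simp: p_def)
    finally show ?thesis .
  qed
  have B0: "0 \<le> B" unfolding B_def by (intro sum_nonneg) auto
  have p: "norm_upto p L \<le> sqrt B" if "0 \<le> L" for L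
  proof -
    have "(norm_upto p L)\<^sup>2 \<le> (1 - frac L) * B + frac L * B"
      unfolding norm_upto_sq[OF that]
      by (intro add_mono mult_left_mono S) (auto intro: less_imp_le simp: frac_lt_1)
    then show ?thesis by (simp add: real_le_rsqrt algebra_simps)
  qed
  have bound: "norm_upto (\<lambda>n. d n * h n) L \<le> sqrt B + \<delta> * norm_upto h L" if L: "0 \<le> L" for L
  proof -
    have "norm_upto (\<lambda>n. d n * h n) L
       = norm_upto (\<lambda>n. p n + (if n < M then 0 else d n * h n)) L"
      by (rule arg_cong[where f = "\<lambda>f. norm_upto f L"]) (auto simp: p_def)
    also have "\<dots> \<le> norm_upto p L + norm_upto (\<lambda>n. if n < M then 0 else d n * h n) L"
      by (rule norm_upto_add[OF L])
    also have "\<dots> \<le> sqrt B + norm_upto (\<lambda>n. \<delta> * h n) L"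
      using M \<delta>(1) by (intro add_mono p L norm_upto_mono) (auto simp: abs_mult mult_right_mono)
    also have "\<dots> = sqrt B + \<delta> * norm_upto h L"
      using \<delta>(1) by (simp add: norm_upto_cmult[OF L])
    finally show ?thesis .
  qed
  have "\<forall>\<^sub>F L in at_top. norm_upto f L \<ge> 2 * sqrt B / e"
    using f by (simp add: filterlim_at_top)
  with K(2) show "\<forall>\<^sub>F L in at_top. norm (norm_upto (\<lambda>n. d n * h n) L) \<le> e * norm (norm_upto f L)"
    using eventually_ge_at_top[of 0]
  proof eventually_elim
    case (elim L)
    have "\<delta> * norm_upto h L \<le> \<delta> * (K * norm_upto f L)"
      using elim \<delta>(1) norm_upto_nonneg[of L f] norm_upto_nonneg[of L h] by (intro mult_left_mono) auto
    also have "\<dots> = e / 2 * norm_upto f L" using \<delta>(2) by (metis mult.assoc)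
    finally have "\<delta> * norm_upto h L \<le> e / 2 * norm_upto f L" .
    moreover have "sqrt B \<le> e / 2 * norm_upto f L" using elim e by (simp add: field_simps)
    ultimately have "norm_upto (\<lambda>n. d n * h n) L \<le> e * norm_upto f L"
      using bound[of L] elim by simp
    then show ?case using elim norm_upto_nonneg[of L] by simp
  qed
qed

lemma norm_upto_bigtheta_of_diff:
  assumes "norm_upto (\<lambda>n. u n - f n) \<in> o(norm_upto f)"
  shows "norm_upto u \<in> \<Theta>(norm_upto (f :: nat \<Rightarrow> real))"
proof -
  have ev: "\<forall>\<^sub>F L in at_top. norm (norm_upto (\<lambda>n. u n - f n) L) \<le> (1/2) * norm (norm_upto f L)"
    by (rule landau_o.smallD[OF assms]) simp
  have ev2: "\<forall>\<^sub>F L in at_top. 0 \<le> L \<and> norm_upto u L \<le> (3/2) * norm_upto f L \<and> norm_upto f L \<le> 2 * norm_upto u L"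
    using ev eventually_ge_at_top[of 0]
  proof eventually_elim
    case (elim L)
    have 1: "norm_upto u L \<le> norm_upto (\<lambda>n. u n - f n) L + norm_upto f L"
      using norm_upto_add[of L "\<lambda>n. u n - f n" f] elim by simp
    have 2: "norm_upto (\<lambda>n. u n + (-1) * (u n - f n)) L \<le> norm_upto u L + norm_upto (\<lambda>n. (-1) * (u n - f n)) L"
      by (rule norm_upto_add) (use elim in simp)
    have "norm_upto (\<lambda>n. (-1) * (u n - f n)) L = norm_upto (\<lambda>n. u n - f n) L"
      using elim by (subst norm_upto_cmult) auto
    then show ?case using 1 2 elim norm_upto_nonneg[of L u] norm_upto_nonneg[of L f]
      norm_upto_nonneg[of L "\<lambda>n. u n - f n"] by simp
  qed
  show ?thesis
  proof (rule bigthetaI)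
    show "norm_upto u \<in> O(norm_upto f)"
      using ev2 by (intro landau_o.bigI[of "3/2"]) (auto elim!: eventually_mono simp: norm_upto_nonneg)
    show "norm_upto u \<in> \<Omega>(norm_upto f)"
      using ev2 by (intro landau_omega.bigI[of "1/2"]) (auto elim!: eventually_mono simp: norm_upto_nonneg)
  qed
qed

text \<open>The entry at \<open>0\<close> carries only the boundary condition.\<close>
lemma norm_upto_cong:
  fixes f g :: "nat \<Rightarrow> real"
  assumes "\<And>n. n \<ge> 1 \<Longrightarrow> f n = g n"
  shows "norm_upto f = norm_upto g"
proof
  fix L :: real
  have "(\<Sum>n=1..nat \<lfloor>L\<rfloor>. (norm (f n))\<^sup>2) = (\<Sum>n=1..nat \<lfloor>L\<rfloor>. (norm (g n))\<^sup>2)"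
    by (rule sum.cong) (use assms in auto)
  then show "norm_upto f L = norm_upto g L"
    using assms by (simp add: norm_upto_def)
qed

lemma filterlim_at_top_of_bigo:
  fixes h k :: "real \<Rightarrow> real"
  assumes "h \<in> O(k)" "filterlim h at_top at_top" "\<forall>\<^sub>F x in at_top. 0 \<le> k x"
  shows "filterlim k at_top at_top"
proof -
  obtain C where C: "C > 0" "\<forall>\<^sub>F x in at_top. norm (h x) \<le> C * norm (k x)"
    using assms(1) by (elim landau_o.bigE)
  have "\<forall>\<^sub>F x in at_top. inverse C * h x \<le> k x"
    using C(2) assms(3) by eventually_elim (use C(1) in \<open>simp add: field_simps\<close>)
  moreover have "filterlim (\<lambda>x. inverse C * h x) at_top at_top"
    using C(1) by (intro filterlim_tendsto_pos_mult_at_top[OF tendsto_const _ assms(2)]) simp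
  ultimately show ?thesis by (rule filterlim_at_top_mono[rotated])
qed

lemma norm_upto_cmult_bigtheta:
  "c \<noteq> 0 \<Longrightarrow> norm_upto (\<lambda>n. c * f n) \<in> \<Theta>(norm_upto (f :: nat \<Rightarrow> real))"
proof -
  assume c: "c \<noteq> 0"
  have "norm_upto (\<lambda>n. c * f n) \<in> \<Theta>(\<lambda>L. \<bar>c\<bar> * norm_upto f L)"
    by (intro bigthetaI_cong eventually_mono[OF eventually_ge_at_top[of 0]] norm_upto_cmult)
  then show ?thesis using c by simp
qed

lemma norm_upto_cmult_bigo:
  "norm_upto (\<lambda>n. c * f n) \<in> O(norm_upto (f :: nat \<Rightarrow> real))"
  by (rule landau_o.bigI[of "\<bar>c\<bar> + 1"])
     (auto intro!: eventually_mono[OF eventually_ge_at_top[of 0]]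
        simp: norm_upto_cmult abs_mult norm_upto_nonneg mult_right_mono)

lemma norm_upto_lincomb_dominant:
  fixes p q :: "nat \<Rightarrow> real"
  assumes "norm_upto p \<in> o(norm_upto q)" "y \<noteq> 0"
  shows "norm_upto (\<lambda>n. x * p n + y * q n) \<in> \<Theta>(norm_upto q)"
proof -
  have y: "norm_upto (\<lambda>n. y * q n) \<in> \<Theta>(norm_upto q)"
    using norm_upto_cmult_bigtheta[OF assms(2)] .
  have "norm_upto (\<lambda>n. x * p n) \<in> o(norm_upto q)"
    by (rule landau_o.big_small_trans[OF norm_upto_cmult_bigo assms(1)])
  then have "norm_upto (\<lambda>n. x * p n) \<in> o(norm_upto (\<lambda>n. y * q n))"
    using y by (simp add: landau_o.small.cong_bigtheta)
  then have "norm_upto (\<lambda>n. (x * p n + y * q n) - y * q n) \<in> o(norm_upto (\<lambda>n. y * q n))"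
    by simp
  then have "norm_upto (\<lambda>n. x * p n + y * q n) \<in> \<Theta>(norm_upto (\<lambda>n. y * q n))"
    by (rule norm_upto_bigtheta_of_diff)
  then show ?thesis using y by (rule landau_theta.trans)
qed

section \<open>Solutions and discrete Wronskians\<close>

lemma is_solution_lincomb:
  "is_solution b E f \<Longrightarrow> is_solution b E g \<Longrightarrow> is_solution b E (\<lambda>n. x * f n + y * g n)"
  unfolding is_solution_def
proof safe
  fix n :: nat
  assume "\<forall>n\<ge>1. f (n + 1) + f (n - 1) + b n * f n = E * f n"
    and "\<forall>n\<ge>1. g (n + 1) + g (n - 1) + b n * g n = E * g n" and "1 \<le> n"
  then have "f (n + 1) + f (n - 1) + b n * f n = E * f n" "g (n + 1) + g (n - 1) + b n * g n = E * g n"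
    by auto
  moreover have "x * f (n + 1) + y * g (n + 1) + (x * f (n - 1) + y * g (n - 1)) + b n * (x * f n + y * g n)
    = x * (f (n + 1) + f (n - 1) + b n * f n) + y * (g (n + 1) + g (n - 1) + b n * g n)"
    by (simp add: algebra_simps)
  ultimately show "x * f (n + 1) + y * g (n + 1) + (x * f (n - 1) + y * g (n - 1)) + b n * (x * f n + y * g n)
    = E * (x * f n + y * g n)"
    by (simp add: algebra_simps)
qed

lemma is_solution_Suc:
  assumes "is_solution b E f"
  shows "f (Suc (Suc n)) = (E - b (Suc n)) * f (Suc n) - f n"
  using assms[unfolded is_solution_def, rule_format, of "Suc n"] by (simp add: algebra_simps)

lemma is_solution_phi1: "is_solution b E (phi1 b E \<theta>)"
  using phi1_unique_solution by blast

lemma is_solution_phi2: "is_solution b E (phi2 b E \<theta>)"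
  unfolding phi2_def by (rule is_solution_phi1)

lemma phi2_initial: "phi2 b E \<theta> 0 = cos \<theta>" "phi2 b E \<theta> (Suc 0) = sin \<theta>"
  by (simp_all add: phi2_def sin_diff cos_diff)

definition wronskian :: "(nat \<Rightarrow> real) \<Rightarrow> (nat \<Rightarrow> real) \<Rightarrow> nat \<Rightarrow> real" where
  "wronskian f g n = f (Suc n) * g n - f n * g (Suc n)"

text \<open>
  Variation of parameters. The Wronskian of two solutions of one equation is constant, so for
  solutions with different potentials only the difference of the potentials moves it.
\<close>
lemma wronskian_perturbed_Suc:
  assumes "is_solution (\<lambda>n. b n + v n) E u" "is_solution b E g"
  shows "wronskian u g (Suc n) = wronskian u g n - v (Suc n) * u (Suc n) * g (Suc n)"
  unfolding wronskian_def is_solution_Suc[OF assms(1)] is_solution_Suc[OF assms(2)]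
  by (simp add: algebra_simps)

lemma wronskian_const:
  assumes "is_solution b E f" "is_solution b E g"
  shows "wronskian f g n = wronskian f g 0"
  using assms wronskian_perturbed_Suc[of b "\<lambda>_. 0" E f g] by (induction n) auto

lemma wronskian_phi: "wronskian (phi1 b E \<theta>) (phi2 b E \<theta>) n = 1"
proof -
  have "wronskian (phi1 b E \<theta>) (phi2 b E \<theta>) 0 = 1"
    using sin_cos_squared_add3[of \<theta>] by (simp add: wronskian_def phi2_initial)
  then show ?thesis
    using wronskian_const[OF is_solution_phi1 is_solution_phi2] by metis
qed

lemma wronskian_swap: "wronskian f g n = - wronskian g f n"
  by (simp add: wronskian_def)

text \<open>
  Cramer's rule: the same two coefficients represent any sequence in the basis \<open>f\<close>, \<open>g\<close> at the sites
  \<open>n\<close> and \<open>n + 1\<close>.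
\<close>
lemma wronskian_expand:
  assumes "wronskian f g n = 1"
  shows "u n = wronskian u g n * f n + wronskian f u n * g n"
    and "u (Suc n) = wronskian u g n * f (Suc n) + wronskian f u n * g (Suc n)"
proof -
  have "wronskian u g n * f n + wronskian f u n * g n = u n * wronskian f g n"
    by (simp add: wronskian_def algebra_simps)
  then show "u n = wronskian u g n * f n + wronskian f u n * g n" using assms by simp
  have "wronskian u g n * f (Suc n) + wronskian f u n * g (Suc n) = u (Suc n) * wronskian f g n"
    by (simp add: wronskian_def algebra_simps)
  then show "u (Suc n) = wronskian u g n * f (Suc n) + wronskian f u n * g (Suc n)" using assms by simp
qed

lemma phi1_rotate:
  "phi1 b E \<theta>' = (\<lambda>n. cos (\<theta>' - \<theta>) * phi1 b E \<theta> n + - sin (\<theta>' - \<theta>) * phi2 b E \<theta> n)" (is "_ = ?r")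
proof -
  have "is_solution b E ?r"
    by (intro is_solution_lincomb is_solution_phi1 is_solution_phi2)
  moreover have "?r 0 = - sin \<theta>'"
    using sin_add[of "\<theta>' - \<theta>" "\<theta>"] by (simp add: phi2_initial)
  moreover have "?r 1 = cos \<theta>'"
    using cos_add[of "\<theta>' - \<theta>" "\<theta>"] by (simp add: phi2_initial)
  ultimately show ?thesis
    using phi1_unique_solution[of b E ?r \<theta>'] by simp
qed

text \<open>A solution cannot vanish at both sites \<open>1\<close> and \<open>2\<close>, since it would vanish identically.\<close>
lemma norm_upto_phi1_pos:
  assumes "2 \<le> L"
  shows "0 < norm_upto (phi1 b E \<theta>) L"
proof -
  have "0 < (cos \<theta>)\<^sup>2 + ((E - b 1) * cos \<theta> + sin \<theta>)\<^sup>2"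
    using sin_cos_squared_add[of \<theta>] by (cases "cos \<theta> = 0") (auto intro: add_pos_nonneg)
  then have "0 < norm_upto (phi1 b E \<theta>) (real 2)"
    unfolding norm_upto_of_nat by (simp add: numeral_2_eq_2)
  then show ?thesis
    using norm_upto_ge_nat[of 2 L "phi1 b E \<theta>"] assms by simp
qed

lemma norm_upto_phi2_pos: "2 \<le> L \<Longrightarrow> 0 < norm_upto (phi2 b E \<theta>) L"
  unfolding phi2_def by (rule norm_upto_phi1_pos)

lemma eventually_norm_upto_phi_pos:
  "\<forall>\<^sub>F L in at_top. 0 < norm_upto (phi1 b E \<theta>) L"
  "\<forall>\<^sub>F L in at_top. 0 < norm_upto (phi2 b E \<theta>) L"
  by (rule eventually_mono[OF eventually_ge_at_top[of 2]], simp add: norm_upto_phi1_pos norm_upto_phi2_pos)+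

lemma subordinate_iff_smallo:
  "subordinate b E \<theta> \<longleftrightarrow> norm_upto (phi1 b E \<theta>) \<in> o(norm_upto (phi2 b E \<theta>))"
proof
  assume sub: "subordinate b E \<theta>"
  have "\<forall>\<^sub>F L in at_top. norm_upto (phi2 b E \<theta>) L \<noteq> 0"
    using eventually_norm_upto_phi_pos(2)[of b E \<theta>] by eventually_elim simp
  then show "norm_upto (phi1 b E \<theta>) \<in> o(norm_upto (phi2 b E \<theta>))"
    using sub unfolding subordinate_def by (intro smalloI_tendsto)
next
  assume "norm_upto (phi1 b E \<theta>) \<in> o(norm_upto (phi2 b E \<theta>))"
  then show "subordinate b E \<theta>"
    unfolding subordinate_def by (rule smalloD_tendsto)
qed

text \<open>
  For passing from a solution given by its initial values to one given by an angle in the interval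
  from which \<open>\<theta>(E)\<close> is taken.
\<close>
lemma polar_angle:
  fixes x y :: real
  assumes "x \<noteq> 0 \<or> y \<noteq> 0"
  obtains \<rho> \<tau> where "\<rho> \<noteq> 0" "\<tau> \<in> {- pi / 2..<pi / 2}" "x = - \<rho> * sin \<tau>" "y = \<rho> * cos \<tau>"
proof (cases "y = 0")
  case True
  then show ?thesis using assms that[of x "- pi / 2"] by simp
next
  case False
  define \<tau> where "\<tau> = arctan (- x / y)"
  have c: "cos \<tau> \<noteq> 0" unfolding \<tau>_def by simp
  have "tan \<tau> = - x / y" unfolding \<tau>_def by (rule tan_arctan)
  then have "sin \<tau> / cos \<tau> = - x / y" by (simp add: tan_def)
  then have "x = - (y / cos \<tau>) * sin \<tau>" using False c by (simp add: field_simps)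
  moreover have "\<tau> \<in> {- pi / 2..<pi / 2}"
    using arctan_bounded[of "- x / y"] unfolding \<tau>_def by auto
  ultimately show ?thesis using that[of "y / cos \<tau>" \<tau>] False c by simp
qed

section \<open>Subordinate solutions and dimensional supports\<close>

text \<open>
  A solution of another angle contains the complementary solution with nonzero coefficient, hence
  grows like it. Two subordinate solutions would each be negligible against the other.
\<close>
lemma subordinate_unique:
  assumes "\<theta>1 \<in> {- pi / 2..<pi / 2}" "\<theta>2 \<in> {- pi / 2..<pi / 2}"
    and "subordinate b E \<theta>1" "subordinate b E \<theta>2"
  shows "\<theta>1 = \<theta>2"
proof (rule ccontr)
  assume ne: "\<theta>1 \<noteq> \<theta>2"
  have sin: "sin (\<theta>1 - \<theta>2) \<noteq> 0"
  proof -
    have "0 < sin (\<theta>1 - \<theta>2)" if "\<theta>2 < \<theta>1" using that assms(1,2) by (intro sin_gt_zero) auto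
    moreover have "0 < sin (\<theta>2 - \<theta>1)" if "\<theta>1 < \<theta>2" using that assms(1,2) by (intro sin_gt_zero) auto
    ultimately show ?thesis using ne sin_minus[of "\<theta>1 - \<theta>2"] by (cases "\<theta>1 < \<theta>2") auto
  qed
  have 1: "norm_upto (phi1 b E \<theta>1) \<in> \<Theta>(norm_upto (phi2 b E \<theta>2))"
    using assms(4) sin unfolding subordinate_iff_smallo
    by (subst phi1_rotate[of _ _ _ \<theta>2]) (rule norm_upto_lincomb_dominant, auto)
  have 2: "norm_upto (phi1 b E \<theta>2) \<in> \<Theta>(norm_upto (phi2 b E \<theta>1))"
    using assms(3) sin sin_minus[of "\<theta>1 - \<theta>2"] unfolding subordinate_iff_smallo
    by (subst phi1_rotate[of _ _ _ \<theta>1]) (rule norm_upto_lincomb_dominant, auto)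
  have "norm_upto (phi1 b E \<theta>1) \<in> o(norm_upto (phi2 b E \<theta>1))"
    using assms(3) by (simp add: subordinate_iff_smallo)
  also have "norm_upto (phi2 b E \<theta>1) \<in> \<Theta>(norm_upto (phi1 b E \<theta>2))"
    using 2 bigtheta_sym by blast
  also have "norm_upto (phi1 b E \<theta>2) \<in> o(norm_upto (phi2 b E \<theta>2))"
    using assms(4) by (simp add: subordinate_iff_smallo)
  also have "norm_upto (phi2 b E \<theta>2) \<in> \<Theta>(norm_upto (phi1 b E \<theta>1))"
    using 1 bigtheta_sym by blast
  finally have "\<forall>\<^sub>F L in at_top. norm_upto (phi1 b E \<theta>1) L = 0"
    by (simp add: landau_o.small_refl_iff)
  with eventually_norm_upto_phi_pos(1)[of b E \<theta>1]
  have "\<forall>\<^sub>F L in (at_top :: real filter). False"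
    by eventually_elim simp
  then show False by simp
qed

lemma theta_eqI:
  assumes "\<theta> \<in> {- pi / 2..<pi / 2}" "subordinate b E \<theta>"
  shows "has_theta b E" "theta b E = \<theta>"
  using assms subordinate_unique unfolding has_theta_def theta_def by blast+

lemma theta_props:
  assumes "has_theta b E"
  shows "theta b E \<in> {- pi / 2..<pi / 2}" "subordinate b E (theta b E)"
  using assms theta_eqI unfolding has_theta_def by metis+

lemma Liminf_ereal_eq_0_iff:
  fixes h :: "real \<Rightarrow> real"
  assumes "\<forall>\<^sub>F x in at_top. 0 \<le> h x"
  shows "Liminf at_top (\<lambda>x. ereal (h x)) = 0 \<longleftrightarrow> (\<forall>e>0. \<exists>\<^sub>F x in at_top. h x < e)"
proof
  assume L: "Liminf at_top (\<lambda>x. ereal (h x)) = 0"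
  show "\<forall>e>0. \<exists>\<^sub>F x in at_top. h x < e"
  proof safe
    fix e :: real assume "e > 0"
    show "\<exists>\<^sub>F x in at_top. h x < e"
    proof (rule ccontr)
      assume "\<not> (\<exists>\<^sub>F x in at_top. h x < e)"
      then have "\<forall>\<^sub>F x in at_top. ereal e \<le> ereal (h x)"
        by (simp add: not_frequently not_less)
      then have "ereal e \<le> Liminf at_top (\<lambda>x. ereal (h x))" by (rule Liminf_bounded)
      with L \<open>e > 0\<close> show False by simp
    qed
  qed
next
  assume fr: "\<forall>e>0. \<exists>\<^sub>F x in at_top. h x < e"
  have "0 \<le> Liminf at_top (\<lambda>x. ereal (h x))"
    using assms by (intro Liminf_bounded) (auto elim: eventually_mono)
  moreover have "Liminf at_top (\<lambda>x. ereal (h x)) \<le> 0"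
  proof (rule ccontr)
    assume "\<not> Liminf at_top (\<lambda>x. ereal (h x)) \<le> 0"
    then have "0 < Liminf at_top (\<lambda>x. ereal (h x))" by simp
    then obtain e where e: "0 < ereal e" "ereal e < Liminf at_top (\<lambda>x. ereal (h x))"
      using ereal_dense2 by blast
    then have "\<forall>\<^sub>F x in at_top. ereal e < ereal (h x)" by (intro less_LiminfD)
    moreover have "\<exists>\<^sub>F x in at_top. h x < e" using fr e(1) by simp
    ultimately have "\<exists>\<^sub>F x in (at_top :: real filter). False"
      by (elim frequently_rev_mp) (auto elim!: eventually_mono)
    then show False by simp
  qed
  ultimately show "Liminf at_top (\<lambda>x. ereal (h x)) = 0" by (rule antisym[rotated])
qed

lemma Liminf_ereal_zero_mono:
  fixes h k :: "real \<Rightarrow> real"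
  assumes "\<forall>\<^sub>F x in at_top. 0 \<le> h x" "\<forall>\<^sub>F x in at_top. 0 \<le> k x" "h \<in> O(k)"
    and "Liminf at_top (\<lambda>x. ereal (k x)) = 0"
  shows "Liminf at_top (\<lambda>x. ereal (h x)) = 0"
proof -
  obtain C where C: "C > 0" "\<forall>\<^sub>F x in at_top. norm (h x) \<le> C * norm (k x)"
    using assms(3) by (elim landau_o.bigE)
  have "\<exists>\<^sub>F x in at_top. h x < e" if "e > 0" for e
  proof -
    have "\<exists>\<^sub>F x in at_top. k x < e / C"
      using assms(4) that C(1) Liminf_ereal_eq_0_iff[OF assms(2)] by simp
    moreover have "\<forall>\<^sub>F x in at_top. k x < e / C \<longrightarrow> h x < e"
      using C(2) assms(1,2)
    proof eventually_elim
      case (elim x)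
      show ?case
      proof
        assume "k x < e / C"
        then have "C * k x < e" using C(1) by (simp add: field_simps)
        then show "h x < e" using elim by simp
      qed
    qed
    ultimately show ?thesis by (rule frequently_rev_mp)
  qed
  then show ?thesis using Liminf_ereal_eq_0_iff[OF assms(1)] by blast
qed

text \<open>
  Both the square summability of the subordinate solution and the vanishing of the lower limit that
  defines the \<open>\<alpha>\<close>-singular support are invariant under bounded changes of the two norms.
\<close>
lemma Sigma_alpha_s_transfer:
  assumes sc: "E \<in> Sigma_sc b" and ht: "has_theta b' E"
    and 1: "norm_upto (phi1 b' E (theta b' E)) \<in> \<Theta>(norm_upto (phi1 b E (theta b E)))"
    and 2: "norm_upto (phi2 b' E (theta b' E)) \<in> \<Theta>(norm_upto (phi2 b E (theta b E)))"
  shows "E \<in> Sigma_alpha_s \<alpha> b' \<longleftrightarrow> E \<in> Sigma_alpha_s \<alpha> b"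
proof -
  let ?f = "norm_upto (phi1 b E (theta b E))" and ?g = "norm_upto (phi2 b E (theta b E))"
  let ?f' = "norm_upto (phi1 b' E (theta b' E))" and ?g' = "norm_upto (phi2 b' E (theta b' E))"
  define p where "p = \<alpha> / (2 - \<alpha>)"
  have "filterlim ?f at_top at_top"
    using sc by (simp add: Sigma_sc_def not_in_l2_iff)
  then have "filterlim ?f' at_top at_top"
    by (rule filterlim_at_top_of_bigo[OF bigthetaD1[OF bigtheta_sym[THEN iffD1, OF 1]]])
       (rule eventually_norm_upto_nonneg)
  then have sc': "E \<in> Sigma_sc b'"
    using ht by (simp add: Sigma_sc_def not_in_l2_iff)
  have th: "(\<lambda>L. ?f' L / ?g' L powr p) \<in> \<Theta>(\<lambda>L. ?f L / ?g L powr p)"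
  proof -
    have "(\<lambda>L. \<bar>?g' L\<bar> powr p) \<in> \<Theta>(\<lambda>L. \<bar>?g L\<bar> powr p)"
      by (intro bigtheta_powr 2)
    then have "(\<lambda>L. ?g' L powr p) \<in> \<Theta>(\<lambda>L. ?g L powr p)"
      by (rule landau_theta.cong_ex[THEN iffD1, rotated 2])
        (auto intro!: eventually_mono[OF eventually_ge_at_top[of 0]] simp: norm_upto_nonneg)
    then show ?thesis using 1 by (intro bigtheta_divide)
  qed
  have pos: "\<forall>\<^sub>F L in at_top. 0 \<le> ?f L / ?g L powr p" "\<forall>\<^sub>F L in at_top. 0 \<le> ?f' L / ?g' L powr p"
    by (auto intro!: eventually_mono[OF eventually_ge_at_top[of 0]] simp: norm_upto_nonneg)
  have "Liminf at_top (\<lambda>L. ereal (?f' L / ?g' L powr p)) = 0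
      \<longleftrightarrow> Liminf at_top (\<lambda>L. ereal (?f L / ?g L powr p)) = 0"
    using Liminf_ereal_zero_mono[OF pos bigthetaD1[OF bigtheta_sym[THEN iffD1, OF th]]]
      Liminf_ereal_zero_mono[OF pos(2) pos(1) bigthetaD1[OF th]] by blast
  then show ?thesis
    using sc sc' unfolding Sigma_alpha_s_def p_def[symmetric]
    by (auto simp: Sigma_sc_def Sigma_pp_def)
qed
section \<open>Power decay against the dominant solution\<close>

text \<open>
  How far the dominant solution can outgrow the subordinate one. The exponent \<open>\<beta>\<close> bounds
  \<open>\<parallel>g\<parallel>\<^sub>L\<close> by a power \<open>1 + q'\<close> of \<open>\<parallel>f\<parallel>\<^sub>L\<close>, where \<open>q'\<close> is any number above \<open>\<eta>(E)\<close>. The excess factor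
  \<open>\<parallel>f\<parallel>\<^sub>L\<^bsup>q'\<^esup>\<close> is at most of order \<open>L\<^bsup>(1/2 + \<epsilon>) q'\<^esup>\<close> by regularity, as no solution grows more slowly than
  the subordinate one.
\<close>
lemma Lambda0_growth:
  assumes E: "E \<in> Lambda0 b" and q: "q > 0" "q > eta b E"
  obtains t C N0 where "0 < t" "t < q / 2" "0 \<le> C"
    "\<And>N. N \<ge> N0 \<Longrightarrow> (\<Sum>n=1..N. (phi2 b E (theta b E) n)\<^sup>2)
       \<le> C * real N powr (2 * t) * (\<Sum>n=1..N. (phi1 b E (theta b E) n)\<^sup>2)"
proof -
  define f where "f = phi1 b E (theta b E)"
  define g where "g = phi2 b E (theta b E)"
  have ht: "has_theta b E" and nl2: "\<not> in_l2 f" and reg: "regular_energy b E" and beta: "beta b E > 0"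
    using E by (auto simp: Lambda0_def Sigma_sc_def f_def)
  have sub: "norm_upto f \<in> o(norm_upto g)"
    using theta_props(2)[OF ht] by (simp add: subordinate_iff_smallo f_def g_def)
  have f_inf: "filterlim (norm_upto f) at_top at_top" using nl2 by (simp add: not_in_l2_iff)
  have f_le_g: "\<forall>\<^sub>F L in at_top. norm_upto f L \<le> norm_upto g L"
    using landau_o.smallD[OF sub zero_less_one] eventually_ge_at_top[of 0]
    by eventually_elim (simp add: norm_upto_nonneg)
  define q' where "q' = (max 0 (eta b E) + q) / 2"
  have q': "0 < q'" "q' < q" "eta b E < q'" using q by (auto simp: q'_def)
  \<comment> \<open>Chosen so that \<open>(1/2 + \<epsilon>) q'\<close> lies halfway between \<open>q'/2\<close> and \<open>q/2\<close>.\<close>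
  define \<epsilon> where "\<epsilon> = (q - q') / (4 * q')"
  have \<epsilon>: "\<epsilon> > 0" using q' by (simp add: \<epsilon>_def)
  define t where "t = (1 / 2 + \<epsilon>) * q'"
  have t: "t = q' / 2 + (q - q') / 4" using q' by (simp add: t_def \<epsilon>_def field_simps)
  have t_bounds: "0 < t" "t < q / 2" using q'(1,2) unfolding t by (simp_all add: field_simps)
  obtain \<theta>r where \<theta>r: "\<And>\<epsilon>. \<epsilon> > 0 \<Longrightarrow> \<exists>C. \<forall>L\<ge>1. norm_upto (phi1 b E \<theta>r) L < C * L powr (1 / 2 + \<epsilon>)"
    using reg unfolding regular_energy_def by blast
  obtain C where C: "\<And>L. L \<ge> 1 \<Longrightarrow> norm_upto (phi1 b E \<theta>r) L < C * L powr (1 / 2 + \<epsilon>)"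
    using \<theta>r[OF \<epsilon>] by blast
  have "norm_upto f \<in> O(norm_upto (phi1 b E \<theta>r))"
  proof (cases "sin (\<theta>r - theta b E) = 0")
    case False
    have "norm_upto (phi1 b E \<theta>r) \<in> \<Theta>(norm_upto g)"
      using sub False unfolding f_def g_def
      by (subst phi1_rotate[of _ _ _ "theta b E"]) (rule norm_upto_lincomb_dominant, auto)
    then have "norm_upto g \<in> O(norm_upto (phi1 b E \<theta>r))"
      by (metis bigthetaD1 bigtheta_sym)
    then show ?thesis
      using landau_o.small_big_trans[OF sub] landau_o.small_imp_big by blast
  next
    case True
    then have "cos (\<theta>r - theta b E) \<noteq> 0" using sin_cos_squared_add[of "\<theta>r - theta b E"] by auto
    then have "norm_upto (phi1 b E \<theta>r) \<in> \<Theta>(norm_upto f)"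
      using True unfolding f_def
      by (subst phi1_rotate[of _ _ _ "theta b E"]) (simp add: norm_upto_cmult_bigtheta)
    then show ?thesis by (metis bigthetaD1 bigtheta_sym)
  qed
  also have "norm_upto (phi1 b E \<theta>r) \<in> O(\<lambda>L. L powr (1 / 2 + \<epsilon>))"
    by (rule landau_o.bigI[of "\<bar>C\<bar> + 1"])
       (auto intro!: eventually_mono[OF eventually_ge_at_top[of 1]] C[THEN less_imp_le, THEN order_trans]
          mult_right_mono simp: norm_upto_nonneg)
  finally obtain D where D: "D > 0" "\<forall>\<^sub>F L in at_top. norm (norm_upto f L) \<le> D * norm (L powr (1 / 2 + \<epsilon>))"
    by (elim landau_o.bigE)
  \<comment> \<open>As \<open>\<beta> = 1 / (1 + \<eta>)\<close>, any \<open>q'\<close> above \<open>\<eta>\<close> gives a value below \<open>\<beta>\<close>, hence below the ratio of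
    logarithms for all large \<open>L\<close>.\<close>
  define \<beta>' where "\<beta>' = 1 / (1 + q')"
  have "1 / beta b E < 1 + q'"
    using q'(3) beta by (simp add: eta_def diff_divide_distrib)
  then have \<beta>': "\<beta>' < beta b E"
    using beta q'(1) by (simp add: \<beta>'_def field_simps)
  have "Liminf at_top (\<lambda>L. ereal (ln (norm_upto f L) / ln (norm_upto g L))) > ereal \<beta>'"
    using \<beta>' beta unfolding beta_def f_def g_def
    by (cases "Liminf at_top (\<lambda>L. ereal (ln (norm_upto (phi1 b E (theta b E)) L) / ln (norm_upto (phi2 b E (theta b E)) L)))")
       auto
  then have ratio: "\<forall>\<^sub>F L in at_top. ln (norm_upto f L) / ln (norm_upto g L) > \<beta>'"
    using less_LiminfD by fastforce
  have "\<forall>\<^sub>F L in at_top. norm_upto f L \<ge> 2" using f_inf by (simp add: filterlim_at_top)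
  with ratio f_le_g D(2) have "\<forall>\<^sub>F L in at_top. norm_upto g L \<le> D powr q' * L powr t * norm_upto f L"
    using eventually_ge_at_top[of 1]
  proof eventually_elim
    case (elim L)
    define x where "x = norm_upto f L"
    define y where "y = norm_upto g L"
    have xy: "2 \<le> x" "x \<le> y" "x \<le> D * L powr (1 / 2 + \<epsilon>)" "\<beta>' < ln x / ln y"
      using elim norm_upto_nonneg[of L f] by (auto simp: x_def y_def)
    have lny: "0 < ln y" using xy by simp
    have "ln y / (1 + q') < ln x" using xy(4) lny by (simp add: \<beta>'_def field_simps)
    then have "ln y < (1 + q') * ln x" using q'(1) by (simp add: field_simps)
    then have "exp (ln y) \<le> exp ((1 + q') * ln x)" by simp
    then have "y \<le> x powr (1 + q')" using xy by (simp add: powr_def)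
    also have "\<dots> = x * x powr q'" using xy by (simp add: powr_add)
    also have "\<dots> \<le> x * (D * L powr (1 / 2 + \<epsilon>)) powr q'"
      using xy q'(1) by (intro mult_left_mono powr_mono2) auto
    also have "\<dots> = D powr q' * L powr t * x"
      using D(1) by (simp add: powr_mult powr_powr t_def)
    finally show ?case by (simp add: x_def y_def)
  qed
  then obtain L0 where L0: "\<And>L. L \<ge> L0 \<Longrightarrow> norm_upto g L \<le> D powr q' * L powr t * norm_upto f L"
    by (auto simp: eventually_at_top_linorder)
  show ?thesis
  proof (rule that)
    show "0 < t" "t < q / 2" "0 \<le> (D powr q')\<^sup>2" using t_bounds by auto
    fix N :: nat assume N: "N \<ge> nat \<lceil>L0\<rceil>"
    have "(norm_upto g (real N))\<^sup>2 \<le> (D powr q' * real N powr t * norm_upto f (real N))\<^sup>2"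
      using N by (intro power_mono L0 norm_upto_nonneg) (auto simp: nat_le_iff ceiling_le_iff)
    also have "\<dots> = (D powr q')\<^sup>2 * real N powr (2 * t) * (norm_upto f (real N))\<^sup>2"
    proof -
      have "(real N powr t)\<^sup>2 = real N powr (2 * t)"
        by (simp only: power2_eq_square powr_add[symmetric] mult_2)
      then show ?thesis by (simp only: power_mult_distrib)
    qed
    finally show "(\<Sum>n=1..N. (phi2 b E (theta b E) n)\<^sup>2)
       \<le> (D powr q')\<^sup>2 * real N powr (2 * t) * (\<Sum>n=1..N. (phi1 b E (theta b E) n)\<^sup>2)"
      by (simp add: norm_upto_of_nat f_def g_def sum_nonneg)
  qed
qed

text \<open>Bernoulli's inequality \<open>(1 + 1/n)\<^bsup>-a\<^esup> \<ge> 1 - a/n\<close>, multiplied by \<open>n\<^bsup>-a\<^esup>\<close>.\<close>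
lemma powr_neg_decrement:
  assumes "0 \<le> a" "n \<ge> (1::nat)"
  shows "real n powr (-a) - real (Suc n) powr (-a) \<le> a * real n powr (-a - 1)"
proof -
  have n: "0 < real n" using assms by simp
  have "real (Suc n) = real n * (1 + 1 / real n)" using n by (simp add: field_simps)
  then have "real (Suc n) powr (-a) = real n powr (-a) * (1 + 1 / real n) powr (-a)"
    using n by (simp add: powr_mult)
  moreover have "1 - a / real n \<le> (1 + 1 / real n) powr (-a)"
  proof -
    have "1 - a / real n \<le> 1 + (-a) * ln (1 + 1 / real n)"
      using mult_left_mono[OF ln_add_one_self_le_self[of "1 / real n"] assms(1)] n by simp
    also have "\<dots> \<le> exp ((-a) * ln (1 + 1 / real n))" by (rule exp_ge_add_one_self)
    also have "\<dots> = (1 + 1 / real n) powr (-a)"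
      using n add_pos_pos[of 1 "1 / real n"] by (simp add: powr_def)
    finally show ?thesis .
  qed
  ultimately have "real n powr (-a) * (1 - a / real n) \<le> real (Suc n) powr (-a)"
    by (simp add: mult_left_mono)
  moreover have "real n powr (-a - 1) = real n powr (-a) / real n"
    using n by (simp add: powr_diff)
  ultimately show ?thesis by (simp add: algebra_simps)
qed

text \<open>
  Summation by parts. Weighting the increments of \<open>\<parallel>g\<parallel>\<^sup>2\<close> by \<open>n\<^bsup>-2s\<^esup>\<close> costs
  \<open>\<Sum> n\<^bsup>-2s-1\<^esup> \<parallel>g\<parallel>\<^sub>n\<^sup>2\<close>, which the growth bound reduces to \<open>\<parallel>f\<parallel>\<^sup>2\<close> times the convergent series
  \<open>\<Sum> n\<^bsup>2t-2s-1\<^esup>\<close>.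
\<close>
lemma norm_upto_powr_weight_bigo:
  fixes f g :: "nat \<Rightarrow> real"
  assumes t: "0 < t" "t < s" and "0 \<le> C"
    and le: "\<And>N. N \<ge> N0 \<Longrightarrow> (\<Sum>n=1..N. (g n)\<^sup>2) \<le> C * real N powr (2 * t) * (\<Sum>n=1..N. (f n)\<^sup>2)"
    and f_inf: "filterlim (norm_upto f) at_top at_top"
  shows "norm_upto (\<lambda>n. real n powr (-s) * g n) \<in> O(norm_upto f)"
proof -
  define F where "F N = (\<Sum>n=1..N. (f n)\<^sup>2)" for N
  define G where "G N = (\<Sum>n=1..N. (g n)\<^sup>2)" for N
  define w where "w n = real n powr (- (2 * s))" for n
  have F_mono: "F m \<le> F n" if "m \<le> n" for m n
    unfolding F_def using that by (intro sum_mono2) auto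
  have "\<forall>\<^sub>F L in at_top. norm_upto f L \<ge> 1" using f_inf by (simp add: filterlim_at_top)
  then obtain L1 where L1: "\<And>L. L \<ge> L1 \<Longrightarrow> norm_upto f L \<ge> 1"
    by (auto simp: eventually_at_top_linorder)
  define N1 where "N1 = max (max N0 1) (nat \<lceil>L1\<rceil>)"
  have N1: "N1 \<ge> N0" "N1 \<ge> 1" "real N1 \<ge> L1" by (auto simp: N1_def) linarith
  have "0 < F N1" using L1[OF N1(3)] unfolding norm_upto_of_nat F_def
    by (metis dual_order.strict_trans1 real_sqrt_gt_0_iff zero_less_one)
  \<comment> \<open>The weighted sum without its boundary term; its increments are \<open>(w N - w (N + 1)) G N\<close>.\<close>
  define P where "P N = (\<Sum>n=1..N. w n * (g n)\<^sup>2) - w N * G N" for N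
  define a where "a n = 2 * s * real n powr (2 * t - 2 * s - 1)" for n
  have a_nonneg: "0 \<le> a n" for n using t by (simp add: a_def)
  have "summable a"
    unfolding a_def using t by (intro summable_mult) (simp add: summable_real_powr_iff)
  then have a_sum: "(\<Sum>n=N1..<N. a n) \<le> suminf a" for N
    using a_nonneg by (intro sum_le_suminf) auto
  have P: "P N \<le> P N1 + C * F N * (\<Sum>n=N1..<N. a n)" if "N \<ge> N1" for N
    using that
  proof (induction N rule: dec_induct)
    case (step N)
    have N: "1 \<le> N" "N0 \<le> N" using step N1 by auto
    have "P (Suc N) - P N = (w N - w (Suc N)) * G N"
      by (simp add: P_def G_def algebra_simps)
    also have "\<dots> \<le> (2 * s * real N powr (- (2 * s) - 1)) * (C * real N powr (2 * t) * F N)"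
      unfolding w_def
    proof (rule mult_mono)
      show "real N powr - (2 * s) - real (Suc N) powr - (2 * s) \<le> 2 * s * real N powr (- (2 * s) - 1)"
        by (rule powr_neg_decrement) (use t N in auto)
      show "G N \<le> C * real N powr (2 * t) * F N" using le[OF N(2)] by (simp add: F_def G_def)
      show "0 \<le> 2 * s * real N powr (- (2 * s) - 1)" using t by simp
      show "0 \<le> G N" unfolding G_def by (intro sum_nonneg) auto
    qed
    also have "\<dots> = C * F N * a N"
      unfolding a_def using N by (simp add: powr_diff powr_minus powr_add field_simps)
    finally have "P (Suc N) \<le> P N1 + C * F N * (\<Sum>n=N1..<Suc N. a n)"
      using step by (simp add: algebra_simps)
    also have "C * F N * (\<Sum>n=N1..<Suc N. a n) \<le> C * F (Suc N) * (\<Sum>n=N1..<Suc N. a n)"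
      using \<open>0 \<le> C\<close> a_nonneg by (intro mult_right_mono mult_left_mono F_mono sum_nonneg) auto
    finally show ?case by simp
  qed simp
  define K where "K = \<bar>P N1\<bar> / F N1 + C * suminf a + C"
  have K: "0 \<le> K"
    unfolding K_def using \<open>0 < F N1\<close> \<open>0 \<le> C\<close> suminf_nonneg[OF \<open>summable a\<close>] a_nonneg by simp
  have "(\<Sum>n=1..N. (real n powr (-s) * g n)\<^sup>2) \<le> (sqrt K)\<^sup>2 * (\<Sum>n=1..N. (f n)\<^sup>2)" if N: "N \<ge> N1" for N
  proof -
    have FN: "F N1 \<le> F N" "0 < F N" using F_mono[OF N] \<open>0 < F N1\<close> by auto
    have "(\<Sum>n=1..N. (real n powr (-s) * g n)\<^sup>2) = (\<Sum>n=1..N. w n * (g n)\<^sup>2)"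
      by (rule sum.cong) (simp_all add: w_def power_mult_distrib power2_eq_square flip: powr_add)
    also have "\<dots> = P N + w N * G N" by (simp add: P_def)
    also have "\<dots> \<le> (P N1 + C * F N * suminf a) + C * F N"
    proof (rule add_mono)
      show "P N \<le> P N1 + C * F N * suminf a"
        using P[OF N] mult_left_mono[OF a_sum[of N], of "C * F N"] \<open>0 \<le> C\<close> FN by simp
      have "w N * G N \<le> w N * (C * real N powr (2 * t) * F N)"
        unfolding G_def F_def using N N1 by (intro mult_left_mono le) (auto simp: w_def)
      also have "\<dots> = C * F N * real N powr (2 * t - 2 * s)"
        by (simp add: w_def powr_diff powr_minus field_simps)
      also have "\<dots> \<le> C * F N * 1"
        using t N N1 \<open>0 \<le> C\<close> FN powr_mono[of "2 * t - 2 * s" 0 "real N"] by (intro mult_left_mono) auto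
      finally show "w N * G N \<le> C * F N" by simp
    qed
    also have "\<dots> \<le> \<bar>P N1\<bar> / F N1 * F N + C * F N * suminf a + C * F N"
    proof -
      have "P N1 \<le> \<bar>P N1\<bar> / F N1 * F N1" using \<open>0 < F N1\<close> by simp
      also have "\<dots> \<le> \<bar>P N1\<bar> / F N1 * F N"
        using FN \<open>0 < F N1\<close> by (intro mult_left_mono) auto
      finally show ?thesis by simp
    qed
    also have "\<dots> = (sqrt K)\<^sup>2 * F N" using K by (simp add: K_def algebra_simps)
    finally show ?thesis by (simp add: F_def)
  qed
  then have "norm_upto (\<lambda>n. real n powr (-s) * g n) L \<le> sqrt K * norm_upto f L" if "L \<ge> real N1" for L
    using that K by (intro norm_upto_le_from_sums[where ?N0.0 = N1]) auto
  then have "\<forall>\<^sub>F L in at_top. norm (norm_upto (\<lambda>n. real n powr (-s) * g n) L) \<le> sqrt K * norm (norm_upto f L)"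
    by (intro eventually_mono[OF eventually_ge_at_top[of "real N1"]])
       (simp add: norm_upto_nonneg order_trans[OF of_nat_0_le_iff])
  then show ?thesis by (rule bigoI)
qed

section \<open>Perturbations with asymptotically free solutions\<close>

text \<open>
  The limits that have to exist for a perturbation \<open>v\<close>, for a basis of the perturbed solutions. The
  weighted series controls the rate at which the coordinate along the dominant solution converges. The
  angle is a free parameter in order that a measurable function of \<open>E\<close> can be put in its place.
\<close>
definition asymptotically_free ::
  "real \<Rightarrow> (nat \<Rightarrow> real) \<Rightarrow> real \<Rightarrow> real \<Rightarrow> (nat \<Rightarrow> real) \<Rightarrow> bool" where
  "asymptotically_free s b E \<theta> v \<longleftrightarrow>
     (\<forall>\<tau>\<in>{\<theta>, \<theta> - pi / 2}.
        convergent (wronskian (phi1 (\<lambda>n. b n + v n) E \<tau>) (phi2 b E \<theta>)) \<and>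
        convergent (\<lambda>N. \<Sum>k=1..N. real k powr s * (v k * phi1 (\<lambda>n. b n + v n) E \<tau> k * phi1 b E \<theta> k)))"

text \<open>
  If a series converges with increasing weights \<open>w\<close>, then without them its tails are \<open>o(1 / w)\<close>: by
  Abel summation a tail is at most \<open>1 / w (n + 1)\<close> times the oscillation of the weighted partial sums
  beyond \<open>n\<close>.
\<close>
lemma abel_tail_vanishes:
  fixes w x :: "nat \<Rightarrow> real"
  assumes w: "\<And>n. n \<ge> 1 \<Longrightarrow> 0 < w n" "\<And>m n. 1 \<le> m \<Longrightarrow> m \<le> n \<Longrightarrow> w m \<le> w n"
    and conv: "convergent (\<lambda>N. \<Sum>k=1..N. w k * x k)"
  shows "\<exists>l. (\<lambda>N. \<Sum>k=1..N. x k) \<longlonglongrightarrow> l \<and> (\<lambda>N. (l - (\<Sum>k=1..N. x k)) * w (Suc N)) \<longlonglongrightarrow> 0"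
proof -
  define W where "W N = (\<Sum>k=1..N. w k * x k)" for N
  define X where "X N = (\<Sum>k=1..N. x k)" for N
  have tail: "\<bar>X N - X n\<bar> \<le> e / w (Suc n)"
    if "n \<le> N" and e: "\<And>k. k \<ge> n \<Longrightarrow> \<bar>W k - W n\<bar> \<le> e" for n N e
  proof -
    have e0: "0 \<le> e" using e[of n] by simp
    \<comment> \<open>Abel summation with the boundary term on the left; the decrements of \<open>1 / w\<close> telescope.\<close>
    have *: "\<bar>X N - X n - (W N - W n) / w N\<bar> \<le> e * (1 / w (Suc n) - 1 / w N)" if "Suc n \<le> N" for N
      using that
    proof (induction N rule: dec_induct)
      case base
      show ?case using w(1)[of "Suc n"] by (simp add: X_def W_def)
    next
      case (step N)
      have pos: "0 < w N" "0 < w (Suc N)" and le: "w N \<le> w (Suc N)" using w step by auto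
      have "X (Suc N) - X n - (W (Suc N) - W n) / w (Suc N)
          = (X N - X n - (W N - W n) / w N) + (W N - W n) * (1 / w N - 1 / w (Suc N))"
        using pos by (simp add: X_def W_def field_simps)
      moreover have "\<bar>(W N - W n) * (1 / w N - 1 / w (Suc N))\<bar> \<le> e * (1 / w N - 1 / w (Suc N))"
        unfolding abs_mult using e[of N] step pos le
        by (intro mult_mono) (auto simp: frac_le)
      ultimately show ?case using step.IH by (simp add: algebra_simps)
    qed
    show ?thesis
    proof (cases "n = N")
      case True
      then show ?thesis using e0 w(1)[of "Suc n"] by simp
    next
      case False
      then have N: "Suc n \<le> N" using that by simp
      have "\<bar>W N - W n\<bar> / w N \<le> e / w N"
        using e[of N] N w(1)[of N] by (intro divide_right_mono) auto
      then have "\<bar>(W N - W n) / w N\<bar> \<le> e / w N"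
        using N w(1)[of N] by simp
      moreover have "e * (1 / w (Suc n) - 1 / w N) = e / w (Suc n) - e / w N"
        by (simp add: right_diff_distrib)
      ultimately show ?thesis using *[OF N] by linarith
    qed
  qed
  have Cauchy: "\<exists>M. \<forall>m\<ge>M. \<forall>n\<ge>M. \<bar>W m - W n\<bar> < e" if "e > 0" for e
    using conv that unfolding Cauchy_convergent_iff[symmetric] Cauchy_iff W_def by simp
  have "Cauchy X"
    unfolding Cauchy_iff
  proof safe
    fix e :: real assume "e > 0"
    then have "e * w 1 / 4 > 0" using w(1)[of 1] by simp
    then obtain M where M: "\<And>m n. m \<ge> M \<Longrightarrow> n \<ge> M \<Longrightarrow> \<bar>W m - W n\<bar> < e * w 1 / 4" using Cauchy by blast
    have 1: "\<bar>X m - X M\<bar> \<le> e / 4" if "m \<ge> M" for m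
    proof -
      have "\<bar>X m - X M\<bar> \<le> e * w 1 / 4 / w (Suc M)"
        by (rule tail[OF that]) (use M in \<open>auto intro: less_imp_le\<close>)
      also have "\<dots> \<le> e * w 1 / 4 / w 1"
        using w(1)[of 1] w(2)[of 1 "Suc M"] \<open>e > 0\<close> by (intro divide_left_mono) auto
      finally show ?thesis using w(1)[of 1] by simp
    qed
    show "\<exists>M. \<forall>m\<ge>M. \<forall>n\<ge>M. norm (X m - X n) < e"
    proof (intro exI allI impI)
      fix m n assume "M \<le> m" "M \<le> n"
      then have "\<bar>X m - X M\<bar> \<le> e / 4" "\<bar>X n - X M\<bar> \<le> e / 4" using 1 by auto
      then show "norm (X m - X n) < e" using \<open>e > 0\<close> unfolding real_norm_def by linarith
    qed
  qed
  then obtain l where l: "X \<longlonglongrightarrow> l" using real_Cauchy_convergent convergentD by blast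
  have "(\<lambda>N. (l - X N) * w (Suc N)) \<longlonglongrightarrow> 0"
  proof (rule LIMSEQ_I)
    fix e :: real assume "e > 0"
    obtain M where M: "\<And>m n. m \<ge> M \<Longrightarrow> n \<ge> M \<Longrightarrow> \<bar>W m - W n\<bar> < e / 2"
      using Cauchy[of "e / 2"] \<open>e > 0\<close> by auto
    show "\<exists>no. \<forall>n\<ge>no. norm ((l - X n) * w (Suc n) - 0) < e"
    proof (intro exI allI impI)
      fix n assume n: "n \<ge> M"
      have "(\<lambda>N. \<bar>X N - X n\<bar>) \<longlonglongrightarrow> \<bar>l - X n\<bar>" by (intro tendsto_intros l)
      moreover have "\<bar>X N - X n\<bar> \<le> e / 2 / w (Suc n)" if "N \<ge> n" for N
        by (rule tail[OF that]) (use M n in \<open>auto intro: less_imp_le\<close>)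
      ultimately have "\<bar>l - X n\<bar> \<le> e / 2 / w (Suc n)"
        by (intro LIMSEQ_le_const2[of _ "\<bar>l - X n\<bar>"]) auto
      then have "\<bar>l - X n\<bar> * w (Suc n) \<le> e / 2" using w(1)[of "Suc n"] by (simp add: field_simps)
      then show "norm ((l - X n) * w (Suc n) - 0) < e"
        using w(1)[of "Suc n"] \<open>e > 0\<close> by (simp add: abs_mult)
    qed
  qed
  with l show ?thesis unfolding X_def by blast
qed

text \<open>
  The increments of the coordinate along the dominant solution are \<open>v u f\<close>, so convergence of their
  weighted series yields a rate.
\<close>
lemma wronskian_decay:
  assumes s: "s > 0"
    and v: "is_solution (\<lambda>n. b n + v n) E u" "is_solution b E f"
    and conv: "convergent (\<lambda>N. \<Sum>k=1..N. real k powr s * (v k * u k * f k))"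
  shows "\<exists>c. wronskian f u \<longlonglongrightarrow> c \<and> (\<lambda>n. (c - wronskian f u n) * real (Suc n) powr s) \<longlonglongrightarrow> 0"
proof -
  have eq: "wronskian f u N = wronskian f u 0 + (\<Sum>k=1..N. v k * u k * f k)" for N
  proof (induction N)
    case (Suc N)
    then show ?case
      using wronskian_perturbed_Suc[OF v, of N] wronskian_swap[of f u] by simp
  qed simp
  obtain l where l: "(\<lambda>N. \<Sum>k=1..N. v k * u k * f k) \<longlonglongrightarrow> l"
    "(\<lambda>N. (l - (\<Sum>k=1..N. v k * u k * f k)) * real (Suc N) powr s) \<longlonglongrightarrow> 0"
  proof -
    have "\<exists>l. (\<lambda>N. \<Sum>k=1..N. v k * u k * f k) \<longlonglongrightarrow> l \<and>
      (\<lambda>N. (l - (\<Sum>k=1..N. v k * u k * f k)) * real (Suc N) powr s) \<longlonglongrightarrow> 0"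
      by (rule abel_tail_vanishes[OF _ _ conv]) (use s in \<open>auto intro: powr_mono2\<close>)
    then show ?thesis using that by blast
  qed
  show ?thesis
  proof (intro exI conjI)
    show "wronskian f u \<longlonglongrightarrow> wronskian f u 0 + l"
      using tendsto_add[OF tendsto_const l(1)] by (subst eq[abs_def])
    show "(\<lambda>n. (wronskian f u 0 + l - wronskian f u n) * real (Suc n) powr s) \<longlonglongrightarrow> 0"
      using l(2) by (subst eq) (simp add: algebra_simps)
  qed
qed

text \<open>
  A solution whose coordinates tend to \<open>(1, 0)\<close> is comparable to \<open>f\<close>. As \<open>g\<close> may be much larger than
  \<open>f\<close>, this needs the rate for the second coordinate, which is used up to make \<open>g\<close> of order at most \<open>f\<close>.
\<close>
lemma norm_upto_asymptotic_subordinate: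
  assumes s: "s > 0" and W: "\<And>n. wronskian f g n = 1"
    and f_inf: "filterlim (norm_upto f) at_top at_top"
    and weight: "norm_upto (\<lambda>n. real n powr (-s) * g n) \<in> O(norm_upto f)"
    and a: "wronskian u g \<longlonglongrightarrow> 1" and c: "(\<lambda>n. wronskian f u n * real (Suc n) powr s) \<longlonglongrightarrow> 0"
  shows "norm_upto u \<in> \<Theta>(norm_upto f)"
proof (rule norm_upto_bigtheta_of_diff)
  define d where "d n = wronskian f u n * real n powr s" for n
  have "d \<longlonglongrightarrow> 0"
  proof (rule Lim_null_comparison[OF _ tendsto_norm_zero[OF c]])
    show "\<forall>\<^sub>F n in sequentially. norm (d n) \<le> norm (wronskian f u n * real (Suc n) powr s)"
      using s by (intro always_eventually allI) (auto simp: d_def abs_mult intro!: mult_left_mono powr_mono2)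
  qed
  then have 1: "norm_upto (\<lambda>n. d n * (real n powr (-s) * g n)) \<in> o(norm_upto f)"
    by (rule norm_upto_vanishing_factor[OF _ f_inf weight])
  have "(\<lambda>n. wronskian u g n - 1) \<longlonglongrightarrow> 0"
    using tendsto_diff[OF a tendsto_const[of 1]] by simp
  then have 2: "norm_upto (\<lambda>n. (wronskian u g n - 1) * f n) \<in> o(norm_upto f)"
    by (rule norm_upto_vanishing_factor[OF _ f_inf]) simp
  have "norm_upto (\<lambda>n. u n - f n)
      = norm_upto (\<lambda>n. (wronskian u g n - 1) * f n + d n * (real n powr (-s) * g n))"
  proof (rule norm_upto_cong)
    fix n :: nat assume "n \<ge> 1"
    then have "d n * (real n powr (-s) * g n) = wronskian f u n * g n"
      by (simp add: d_def powr_minus)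
    then show "u n - f n = (wronskian u g n - 1) * f n + d n * (real n powr (-s) * g n)"
      using wronskian_expand(1)[OF W, of u n] by (simp only:) (simp add: algebra_simps)
  qed
  then show "norm_upto (\<lambda>n. u n - f n) \<in> o(norm_upto f)"
    using norm_upto_add_smallo[OF 2 1] by simp
qed

text \<open>For the dominant direction mere convergence of the coordinates is enough.\<close>
lemma norm_upto_asymptotic_dominant:
  assumes W: "\<And>n. wronskian f g n = 1"
    and g_inf: "filterlim (norm_upto g) at_top at_top"
    and fg: "norm_upto f \<in> o(norm_upto g)"
    and a: "wronskian u g \<longlonglongrightarrow> 0" and c: "wronskian f u \<longlonglongrightarrow> 1"
  shows "norm_upto u \<in> \<Theta>(norm_upto g)"
proof (rule norm_upto_bigtheta_of_diff)
  have 1: "norm_upto (\<lambda>n. wronskian u g n * f n) \<in> o(norm_upto g)"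
    by (rule norm_upto_vanishing_factor[OF a g_inf landau_o.small_imp_big[OF fg]])
  have "(\<lambda>n. wronskian f u n - 1) \<longlonglongrightarrow> 0"
    using tendsto_diff[OF c tendsto_const[of 1]] by simp
  then have 2: "norm_upto (\<lambda>n. (wronskian f u n - 1) * g n) \<in> o(norm_upto g)"
    by (rule norm_upto_vanishing_factor[OF _ g_inf]) simp
  have "(\<lambda>n. u n - g n) = (\<lambda>n. wronskian u g n * f n + (wronskian f u n - 1) * g n)"
    using wronskian_expand(1)[OF W, of u] by (simp add: algebra_simps fun_eq_iff)
  then show "norm_upto (\<lambda>n. u n - g n) \<in> o(norm_upto g)"
    using norm_upto_add_smallo[OF 1 2] by simp
qed

text \<open>
  Invertibility of the limit matrix of coordinates provides perturbed solutions \<open>u\<close> and \<open>w\<close> that are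
  comparable to \<open>f\<close> and \<open>g\<close>. Then \<open>u\<close> is negligible against \<open>w\<close>, so it is subordinate up to a factor,
  and any other solution is comparable to \<open>w\<close>.
\<close>
lemma asymptotically_free_transfer:
  fixes b v :: "nat \<Rightarrow> real"
  defines "b' \<equiv> \<lambda>n. b n + v n"
  assumes E: "E \<in> Lambda0 b" and q: "q > 0" "q > eta b E"
    and free: "asymptotically_free (q / 2) b E (theta b E) v"
  shows "E \<in> Sigma_alpha_s \<alpha> b' \<longleftrightarrow> E \<in> Sigma_alpha_s \<alpha> b"
proof -
  define f where "f = phi1 b E (theta b E)"
  define g where "g = phi2 b E (theta b E)"
  define s where "s = q / 2"
  have s: "s > 0" using q by (simp add: s_def)
  have sc: "E \<in> Sigma_sc b" using E by (simp add: Lambda0_def)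
  then have ht: "has_theta b E" and f_inf: "filterlim (norm_upto f) at_top at_top"
    by (auto simp: Sigma_sc_def f_def not_in_l2_iff)
  have fg: "norm_upto f \<in> o(norm_upto g)"
    using theta_props(2)[OF ht] by (simp add: subordinate_iff_smallo f_def g_def)
  have g_inf: "filterlim (norm_upto g) at_top at_top"
    by (rule filterlim_at_top_of_bigo[OF landau_o.small_imp_big[OF fg] f_inf eventually_norm_upto_nonneg])
  have W: "wronskian f g n = 1" for n by (simp add: f_def g_def wronskian_phi)
  have sol: "is_solution b E f" "is_solution b E g"
    by (simp_all add: f_def g_def is_solution_phi1 is_solution_phi2)
  have weight: "norm_upto (\<lambda>n. real n powr (-s) * g n) \<in> O(norm_upto f)"
  proof -
    obtain t C N0 where "0 < t" "t < q / 2" "0 \<le> C"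
      "\<And>N. N \<ge> N0 \<Longrightarrow> (\<Sum>n=1..N. (g n)\<^sup>2) \<le> C * real N powr (2 * t) * (\<Sum>n=1..N. (f n)\<^sup>2)"
      using Lambda0_growth[OF E q] unfolding f_def g_def by blast
    then show ?thesis
      by (intro norm_upto_powr_weight_bigo[OF _ _ _ _ f_inf]) (auto simp: s_def)
  qed
  define U where "U = phi1 b' E (theta b E)"
  define V where "V = phi2 b' E (theta b E)"
  have solUV: "is_solution b' E U" "is_solution b' E V"
    by (simp_all add: U_def V_def is_solution_phi1 is_solution_phi2)
  have UV: "wronskian U V n = 1" for n by (simp add: U_def V_def wronskian_phi)
  obtain aU aV where a: "wronskian U g \<longlonglongrightarrow> aU" "wronskian V g \<longlonglongrightarrow> aV"
    using free unfolding asymptotically_free_def U_def V_def g_def b'_def phi2_def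
    by (auto simp: convergent_def)
  have "\<exists>c. wronskian f U \<longlonglongrightarrow> c \<and> (\<lambda>n. (c - wronskian f U n) * real (Suc n) powr s) \<longlonglongrightarrow> 0"
    using free unfolding asymptotically_free_def
    by (intro wronskian_decay[OF s solUV(1)[unfolded b'_def] sol(1)]) (simp add: U_def f_def b'_def s_def)
  then obtain cU where cU: "wronskian f U \<longlonglongrightarrow> cU" "(\<lambda>n. (cU - wronskian f U n) * real (Suc n) powr s) \<longlonglongrightarrow> 0"
    by blast
  have "\<exists>c. wronskian f V \<longlonglongrightarrow> c \<and> (\<lambda>n. (c - wronskian f V n) * real (Suc n) powr s) \<longlonglongrightarrow> 0"
    using free unfolding asymptotically_free_def
    by (intro wronskian_decay[OF s solUV(2)[unfolded b'_def] sol(1)]) (simp add: V_def f_def b'_def s_def phi2_def)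
  then obtain cV where cV: "wronskian f V \<longlonglongrightarrow> cV" "(\<lambda>n. (cV - wronskian f V n) * real (Suc n) powr s) \<longlonglongrightarrow> 0"
    by blast
  \<comment> \<open>Pluecker relation: the determinant of the coordinates is the Wronskian of \<open>U\<close> and \<open>V\<close>.\<close>
  have "wronskian U g n * wronskian f V n - wronskian V g n * wronskian f U n = 1" for n
  proof -
    have "wronskian U g n * wronskian f V n - wronskian V g n * wronskian f U n = wronskian U V n * wronskian f g n"
      by (simp add: wronskian_def algebra_simps)
    then show ?thesis by (simp add: UV W)
  qed
  then have "(\<lambda>n. wronskian U g n * wronskian f V n - wronskian V g n * wronskian f U n) \<longlonglongrightarrow> 1"
    by simp
  moreover have "(\<lambda>n. wronskian U g n * wronskian f V n - wronskian V g n * wronskian f U n) \<longlonglongrightarrow> aU * cV - aV * cU"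
    by (intro tendsto_intros a cU cV)
  ultimately have det: "aU * cV - aV * cU = 1" using LIMSEQ_unique by metis
  have wl: "wronskian (\<lambda>n. x * U n + y * V n) h n = x * wronskian U h n + y * wronskian V h n"
    "wronskian h (\<lambda>n. x * U n + y * V n) n = x * wronskian h U n + y * wronskian h V n" for x y h n
    by (simp_all add: wronskian_def algebra_simps)
  \<comment> \<open>Their coefficients are the columns of the inverse of the limit matrix, so the limit coordinates
    of \<open>u\<close> and \<open>w\<close> are \<open>(1, 0)\<close> and \<open>(0, 1)\<close>.\<close>
  define u where "u n = cV * U n + (- cU) * V n" for n
  define w where "w n = (- aV) * U n + aU * V n" for n
  have solu: "is_solution b' E u" "is_solution b' E w"
    unfolding u_def[abs_def] w_def[abs_def] by (intro is_solution_lincomb solUV)+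
  have u: "norm_upto u \<in> \<Theta>(norm_upto f)"
  proof (rule norm_upto_asymptotic_subordinate[OF s W f_inf weight])
    have "(\<lambda>n. cV * wronskian U g n + (- cU) * wronskian V g n) \<longlonglongrightarrow> cV * aU + (- cU) * aV"
      by (intro tendsto_intros a)
    then show "wronskian u g \<longlonglongrightarrow> 1" using det unfolding u_def[abs_def] wl[abs_def] by (simp add: mult.commute)
    have "(\<lambda>n. cU * ((cV - wronskian f V n) * real (Suc n) powr s) - cV * ((cU - wronskian f U n) * real (Suc n) powr s)) \<longlonglongrightarrow> cU * 0 - cV * 0"
      by (intro tendsto_intros cU cV)
    then show "(\<lambda>n. wronskian f u n * real (Suc n) powr s) \<longlonglongrightarrow> 0"
      unfolding u_def[abs_def] wl by (simp add: algebra_simps)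
  qed
  have w: "norm_upto w \<in> \<Theta>(norm_upto g)"
  proof (rule norm_upto_asymptotic_dominant[OF W g_inf fg])
    have "(\<lambda>n. (- aV) * wronskian U g n + aU * wronskian V g n) \<longlonglongrightarrow> (- aV) * aU + aU * aV"
      by (intro tendsto_intros a)
    then show "wronskian w g \<longlonglongrightarrow> 0" unfolding w_def[abs_def] wl[abs_def] by simp
    have "(\<lambda>n. (- aV) * wronskian f U n + aU * wronskian f V n) \<longlonglongrightarrow> (- aV) * cU + aU * cV"
      by (intro tendsto_intros cU cV)
    then show "wronskian f w \<longlonglongrightarrow> 1" using det unfolding w_def[abs_def] wl[abs_def] by simp
  qed
  have uw: "wronskian u w n = 1" for n
  proof -
    have "wronskian u w n = (aU * cV - aV * cU) * wronskian U V n"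
      by (simp add: wronskian_def u_def w_def algebra_simps)
    then show ?thesis by (simp add: det UV)
  qed
  have "norm_upto u \<in> \<Theta>(norm_upto f)" by (fact u)
  also have "norm_upto f \<in> o(norm_upto g)" by (fact fg)
  also have "norm_upto g \<in> \<Theta>(norm_upto w)" using w bigtheta_sym by blast
  finally have u_o_w: "norm_upto u \<in> o(norm_upto w)" .
  have "u 0 \<noteq> 0 \<or> u 1 \<noteq> 0" using uw[of 0] by (auto simp: wronskian_def)
  then obtain \<rho> \<tau> where \<rho>: "\<rho> \<noteq> 0" "\<tau> \<in> {- pi / 2..<pi / 2}" "u 0 = - \<rho> * sin \<tau>" "u 1 = \<rho> * cos \<tau>"
    by (rule polar_angle)
  have u_eq: "phi1 b' E \<tau> = (\<lambda>n. (1 / \<rho>) * u n)"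
  proof -
    have "is_solution b' E (\<lambda>n. (1 / \<rho>) * u n + 0 * u n)"
      by (intro is_solution_lincomb solu)
    then show ?thesis
      using phi1_unique_solution[of b' E "\<lambda>n. (1 / \<rho>) * u n" \<tau>] \<rho> by simp
  qed
  have n1: "norm_upto (phi1 b' E \<tau>) \<in> \<Theta>(norm_upto u)"
    unfolding u_eq using \<rho>(1) by (intro norm_upto_cmult_bigtheta) simp
  have n2: "norm_upto (phi2 b' E \<tau>) \<in> \<Theta>(norm_upto w)"
  proof -
    have eq: "phi2 b' E \<tau> n = wronskian (phi2 b' E \<tau>) w 0 * u n + wronskian u (phi2 b' E \<tau>) 0 * w n" for n
      using wronskian_expand(1)[OF uw, of "phi2 b' E \<tau>" n]
        wronskian_const[OF is_solution_phi2 solu(2), of \<tau> n] wronskian_const[OF solu(1) is_solution_phi2, of \<tau> n]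
      by simp
    have "wronskian (phi1 b' E \<tau>) (phi2 b' E \<tau>) 0 = (1 / \<rho>) * wronskian u (phi2 b' E \<tau>) 0"
      unfolding u_eq by (simp add: wronskian_def diff_divide_distrib)
    then have "wronskian u (phi2 b' E \<tau>) 0 \<noteq> 0" by (auto simp: wronskian_phi)
    then show ?thesis
      by (subst eq[abs_def]) (rule norm_upto_lincomb_dominant[OF u_o_w])
  qed
  have "norm_upto (phi1 b' E \<tau>) \<in> \<Theta>(norm_upto u)" by (fact n1)
  also note u_o_w
  also have "norm_upto w \<in> \<Theta>(norm_upto (phi2 b' E \<tau>))" using n2 bigtheta_sym by blast
  finally have "subordinate b' E \<tau>" by (simp add: subordinate_iff_smallo)
  note th = theta_eqI[OF \<rho>(2) this]
  show ?thesis
  proof (rule Sigma_alpha_s_transfer[OF sc th(1)])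
    show "norm_upto (phi1 b' E (theta b' E)) \<in> \<Theta>(norm_upto (phi1 b E (theta b E)))"
      using landau_theta.trans[OF n1 u] by (simp add: th(2) f_def)
    show "norm_upto (phi2 b' E (theta b' E)) \<in> \<Theta>(norm_upto (phi2 b E (theta b E)))"
      using landau_theta.trans[OF n2 w] by (simp add: th(2) g_def)
  qed
qed
section \<open>Martingale transforms of centered noise\<close>

lemma (in prob_space) integrable_mult_of_squares:
  fixes X Y :: "'a \<Rightarrow> real"
  assumes [measurable]: "X \<in> borel_measurable M" "Y \<in> borel_measurable M"
    and "integrable M (\<lambda>\<omega>. (X \<omega>)\<^sup>2)" "integrable M (\<lambda>\<omega>. (Y \<omega>)\<^sup>2)"
  shows "integrable M (\<lambda>\<omega>. X \<omega> * Y \<omega>)"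
proof (rule Bochner_Integration.integrable_bound)
  show "integrable M (\<lambda>\<omega>. (X \<omega>)\<^sup>2 + (Y \<omega>)\<^sup>2)" using assms by auto
  show "AE \<omega> in M. norm (X \<omega> * Y \<omega>) \<le> norm ((X \<omega>)\<^sup>2 + (Y \<omega>)\<^sup>2)"
  proof (rule AE_I2)
    fix \<omega>
    have "2 * (\<bar>X \<omega>\<bar> * \<bar>Y \<omega>\<bar>) \<le> (X \<omega>)\<^sup>2 + (Y \<omega>)\<^sup>2"
      using sum_squares_bound[of "\<bar>X \<omega>\<bar>" "\<bar>Y \<omega>\<bar>"] by simp
    moreover have "0 \<le> \<bar>X \<omega>\<bar> * \<bar>Y \<omega>\<bar>" by simp
    ultimately show "norm (X \<omega> * Y \<omega>) \<le> norm ((X \<omega>)\<^sup>2 + (Y \<omega>)\<^sup>2)"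
      unfolding real_norm_def abs_mult by linarith
  qed
qed measurable

lemma (in prob_space) integrable_square_add:
  fixes X Y :: "'a \<Rightarrow> real"
  assumes "X \<in> borel_measurable M" "Y \<in> borel_measurable M"
    and "integrable M (\<lambda>\<omega>. (X \<omega>)\<^sup>2)" "integrable M (\<lambda>\<omega>. (Y \<omega>)\<^sup>2)"
  shows "integrable M (\<lambda>\<omega>. (X \<omega> + Y \<omega>)\<^sup>2)"
proof -
  have "integrable M (\<lambda>\<omega>. (X \<omega>)\<^sup>2 + (Y \<omega>)\<^sup>2 + 2 * (X \<omega> * Y \<omega>))"
    using assms integrable_mult_of_squares[OF assms] by simp
  then show ?thesis by (simp add: power2_sum algebra_simps)
qed

text \<open>
  The noise starts at index \<open>1\<close>, so \<open>F 0\<close> is the past before any noise has been seen. Independence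
  from the past is stated for the random variables known at time \<open>n\<close>, which is the form used for
  products.
\<close>
locale centered_noise = prob_space M for M :: "'a measure" +
  fixes F :: "nat \<Rightarrow> 'a measure" and v :: "nat \<Rightarrow> 'a \<Rightarrow> real"
  assumes subalgebra_F: "\<And>n. subalgebra M (F n)"
    and filtration: "\<And>m n. m \<le> n \<Longrightarrow> sets (F m) \<subseteq> sets (F n)"
    and adapted: "\<And>n. v (Suc n) \<in> borel_measurable (F (Suc n))"
    and indep_past: "\<And>n X. X \<in> borel_measurable (F n) \<Longrightarrow> indep_var borel X borel (v (Suc n))"
    and centered: "\<And>n. expectation (v (Suc n)) = 0"
    and square_integrable: "\<And>n. integrable M (\<lambda>\<omega>. (v (Suc n) \<omega>)\<^sup>2)"
begin

lemma measurable_F_M: "X \<in> borel_measurable (F n) \<Longrightarrow> (X :: 'a \<Rightarrow> real) \<in> borel_measurable M"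
  using subalgebra_F[of n] by (rule measurable_from_subalg)

lemma measurable_F_mono:
  "X \<in> borel_measurable (F m) \<Longrightarrow> m \<le> n \<Longrightarrow> (X :: 'a \<Rightarrow> real) \<in> borel_measurable (F n)"
  by (rule measurable_from_subalg[of "F n" "F m"])
     (use subalgebra_F filtration in \<open>auto simp: subalgebra_def\<close>)

lemma noise_measurable: "v (Suc n) \<in> borel_measurable M"
  using adapted by (rule measurable_F_M)

lemma noise_integrable: "integrable M (v (Suc n))"
  using square_integrable_imp_integrable[OF noise_measurable square_integrable] .

lemma past_times_noise:
  assumes X: "(X :: 'a \<Rightarrow> real) \<in> borel_measurable (F n)" and X2: "integrable M (\<lambda>\<omega>. (X \<omega>)\<^sup>2)"
  shows "integrable M (\<lambda>\<omega>. (X \<omega> * v (Suc n) \<omega>)\<^sup>2)"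
    and "expectation (\<lambda>\<omega>. (X \<omega> * v (Suc n) \<omega>)\<^sup>2)
      = expectation (\<lambda>\<omega>. (X \<omega>)\<^sup>2) * expectation (\<lambda>\<omega>. (v (Suc n) \<omega>)\<^sup>2)"
proof -
  have ind: "indep_var borel (\<lambda>\<omega>. (X \<omega>)\<^sup>2) borel (\<lambda>\<omega>. (v (Suc n) \<omega>)\<^sup>2)"
    using indep_var_compose[OF indep_past[OF X], of "\<lambda>x. x\<^sup>2" borel "\<lambda>x. x\<^sup>2" borel]
    by (simp add: comp_def)
  show "integrable M (\<lambda>\<omega>. (X \<omega> * v (Suc n) \<omega>)\<^sup>2)"
    using indep_var_integrable[OF ind X2 square_integrable] by (simp add: power_mult_distrib)
  show "expectation (\<lambda>\<omega>. (X \<omega> * v (Suc n) \<omega>)\<^sup>2)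
      = expectation (\<lambda>\<omega>. (X \<omega>)\<^sup>2) * expectation (\<lambda>\<omega>. (v (Suc n) \<omega>)\<^sup>2)"
    using indep_var_lebesgue_integral[OF ind X2 square_integrable] by (simp add: power_mult_distrib)
qed

lemma noise_orthogonal_past:
  assumes X: "(X :: 'a \<Rightarrow> real) \<in> borel_measurable (F n)" and Z: "Z \<in> borel_measurable (F n)"
    and "integrable M (\<lambda>\<omega>. (X \<omega>)\<^sup>2)" "integrable M (\<lambda>\<omega>. (Z \<omega>)\<^sup>2)"
  shows "integrable M (\<lambda>\<omega>. Z \<omega> * (X \<omega> * v (Suc n) \<omega>))"
    and "expectation (\<lambda>\<omega>. Z \<omega> * (X \<omega> * v (Suc n) \<omega>)) = 0"
proof -
  have i: "integrable M (\<lambda>\<omega>. Z \<omega> * X \<omega>)"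
    using X Z assms(3,4) by (intro integrable_mult_of_squares measurable_F_M)
  have "(\<lambda>\<omega>. Z \<omega> * X \<omega>) \<in> borel_measurable (F n)" using X Z by measurable
  note ind = indep_past[OF this]
  show "integrable M (\<lambda>\<omega>. Z \<omega> * (X \<omega> * v (Suc n) \<omega>))"
    using indep_var_integrable[OF ind i noise_integrable] by (simp add: mult.assoc)
  show "expectation (\<lambda>\<omega>. Z \<omega> * (X \<omega> * v (Suc n) \<omega>)) = 0"
    using indep_var_lebesgue_integral[OF ind i noise_integrable] by (simp add: mult.assoc centered)
qed

text \<open>
  The martingale transform of the noise: the factor \<open>Y k\<close> is meant to be known at time \<open>k\<close> and multiplies
  the noise at time \<open>k + 1\<close>.
\<close>
definition transform :: "(nat \<Rightarrow> 'a \<Rightarrow> real) \<Rightarrow> nat \<Rightarrow> 'a \<Rightarrow> real" where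
  "transform Y N \<omega> = (\<Sum>k<N. Y k \<omega> * v (Suc k) \<omega>)"

lemma transform_measurable:
  assumes "\<And>k. Y k \<in> borel_measurable (F k)"
  shows "transform Y N \<in> borel_measurable (F N)"
  unfolding transform_def[abs_def]
  by (intro borel_measurable_sum borel_measurable_times)
     (auto intro: measurable_F_mono[OF assms] measurable_F_mono[OF adapted])

lemma transform_isometry:
  assumes Y: "\<And>k. Y k \<in> borel_measurable (F k)" "\<And>k. integrable M (\<lambda>\<omega>. (Y k \<omega>)\<^sup>2)"
  shows "integrable M (\<lambda>\<omega>. (transform Y N \<omega>)\<^sup>2)"
    and "expectation (\<lambda>\<omega>. (transform Y N \<omega>)\<^sup>2)
      = (\<Sum>k<N. expectation (\<lambda>\<omega>. (Y k \<omega>)\<^sup>2) * expectation (\<lambda>\<omega>. (v (Suc k) \<omega>)\<^sup>2))"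
proof (induction N)
  case 0
  { case 1 show ?case by (simp add: transform_def) }
  { case 2 show ?case by (simp add: transform_def) }
next
  case (Suc N)
  have eq: "(transform Y (Suc N) \<omega>)\<^sup>2
      = (transform Y N \<omega>)\<^sup>2 + (Y N \<omega> * v (Suc N) \<omega>)\<^sup>2 + 2 * (transform Y N \<omega> * (Y N \<omega> * v (Suc N) \<omega>))" for \<omega>
    unfolding transform_def by (simp add: power2_sum)
  note [simp] = Suc past_times_noise[OF Y] noise_orthogonal_past[OF Y(1) transform_measurable[OF Y(1)] Y(2) Suc(1)]
  { case 1 show ?case unfolding eq by simp }
  { case 2 show ?case unfolding eq by simp }
qed

text \<open>
  Stopping the transform at its first exit from \<open>(-e, e)\<close> gives another transform, because the decision
  to stop is known at the time at which the factor is. It ends outside \<open>(-e, e)\<close> exactly if the original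
  one has left that interval, so Chebyshev's inequality at the final time suffices.
\<close>
lemma kolmogorov_inequality:
  assumes Y: "\<And>k. Y k \<in> borel_measurable (F k)" "\<And>k. integrable M (\<lambda>\<omega>. (Y k \<omega>)\<^sup>2)"
    and e: "e > 0"
  shows "prob {\<omega> \<in> space M. \<exists>n\<le>N. e \<le> \<bar>transform Y n \<omega>\<bar>}
    \<le> (\<Sum>k<N. expectation (\<lambda>\<omega>. (Y k \<omega>)\<^sup>2) * expectation (\<lambda>\<omega>. (v (Suc k) \<omega>)\<^sup>2)) / e\<^sup>2"
proof -
  define Y' where "Y' k \<omega> = (if \<forall>j\<le>k. \<bar>transform Y j \<omega>\<bar> < e then Y k \<omega> else 0)" for k \<omega>
  have tm: "transform Y j \<in> borel_measurable (F k)" if "j \<le> k" for j k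
    using measurable_F_mono[OF transform_measurable[OF Y(1)] that] .
  have Y'm: "Y' k \<in> borel_measurable (F k)" for k
  proof -
    have "Measurable.pred (F k) (\<lambda>\<omega>. \<forall>j\<in>{..k}. \<bar>transform Y j \<omega>\<bar> < e)"
    proof (rule pred_intros_finite)
      fix j assume "j \<in> {..k}"
      then have [measurable]: "transform Y j \<in> borel_measurable (F k)" by (intro tm) simp
      show "Measurable.pred (F k) (\<lambda>\<omega>. \<bar>transform Y j \<omega>\<bar> < e)" by measurable
    qed simp
    then have "{\<omega> \<in> space (F k). \<forall>j\<le>k. \<bar>transform Y j \<omega>\<bar> < e} \<in> sets (F k)"
      by (simp only: Ball_def atMost_iff pred_def)
    then show ?thesis unfolding Y'_def by (intro measurable_If Y(1) borel_measurable_const)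
  qed
  have sq_le: "(Y' k \<omega>)\<^sup>2 \<le> (Y k \<omega>)\<^sup>2" for k \<omega> by (simp add: Y'_def)
  have Y'2: "integrable M (\<lambda>\<omega>. (Y' k \<omega>)\<^sup>2)" for k
    by (rule Bochner_Integration.integrable_bound[OF Y(2)[of k]])
       (use measurable_F_M[OF Y'm] sq_le in auto)
  have stop: "e \<le> \<bar>transform Y' N \<omega>\<bar>" if "n \<le> N" "e \<le> \<bar>transform Y n \<omega>\<bar>" for n \<omega>
  proof -
    define m where "m = (LEAST n. e \<le> \<bar>transform Y n \<omega>\<bar>)"
    have m: "e \<le> \<bar>transform Y m \<omega>\<bar>" "m \<le> n"
      unfolding m_def using that(2) by (rule LeastI, rule Least_le)
    have lt: "\<bar>transform Y j \<omega>\<bar> < e" if "j < m" for j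
      using not_less_Least[of j "\<lambda>n. e \<le> \<bar>transform Y n \<omega>\<bar>"] that unfolding m_def by auto
    have "transform Y' N \<omega> = (\<Sum>k<m. Y' k \<omega> * v (Suc k) \<omega>)"
      unfolding transform_def using m that(1)
      by (intro sum.mono_neutral_right) (auto simp: Y'_def not_less dest!: spec[of _ m])
    also have "\<dots> = transform Y m \<omega>"
      unfolding transform_def by (intro sum.cong) (auto simp: Y'_def lt)
    finally show ?thesis using m by simp
  qed
  have [measurable]: "transform Y n \<in> borel_measurable M" "transform Y' n \<in> borel_measurable M" for n
    using measurable_F_M[OF transform_measurable] Y(1) Y'm by auto
  have "prob {\<omega> \<in> space M. \<exists>n\<le>N. e \<le> \<bar>transform Y n \<omega>\<bar>} \<le> prob {\<omega> \<in> space M. e \<le> \<bar>transform Y' N \<omega>\<bar>}"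
    using stop by (intro finite_measure_mono) auto
  also have "\<dots> \<le> prob {\<omega> \<in> space M. e\<^sup>2 \<le> (transform Y' N \<omega>)\<^sup>2}"
    using e by (intro finite_measure_mono) (auto simp: abs_le_square_iff[symmetric])
  also have "\<dots> \<le> expectation (\<lambda>\<omega>. (transform Y' N \<omega>)\<^sup>2) / e\<^sup>2"
    using e transform_isometry(1)[OF Y'm Y'2]
    by (intro integral_Markov_inequality_measure[where A = "space M"]) auto
  also have "expectation (\<lambda>\<omega>. (transform Y' N \<omega>)\<^sup>2)
      \<le> (\<Sum>k<N. expectation (\<lambda>\<omega>. (Y k \<omega>)\<^sup>2) * expectation (\<lambda>\<omega>. (v (Suc k) \<omega>)\<^sup>2))"
    unfolding transform_isometry(2)[OF Y'm Y'2]
    by (intro sum_mono mult_right_mono integral_mono Y'2 Y(2) sq_le integral_nonneg) auto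
  finally show ?thesis using e by (simp add: divide_right_mono)
qed

text \<open>
  The maximal inequality, applied to the transform restarted at \<open>m\<close>, bounds the probability of an
  oscillation of size \<open>e\<close> beyond \<open>m\<close> by a tail of the convergent series; so almost surely the partial
  sums are Cauchy.
\<close>
lemma transform_converges:
  assumes Y: "\<And>k. Y k \<in> borel_measurable (F k)" "\<And>k. integrable M (\<lambda>\<omega>. (Y k \<omega>)\<^sup>2)"
    and sm: "summable (\<lambda>k. expectation (\<lambda>\<omega>. (Y k \<omega>)\<^sup>2) * expectation (\<lambda>\<omega>. (v (Suc k) \<omega>)\<^sup>2))"
  shows "AE \<omega> in M. convergent (\<lambda>N. transform Y N \<omega>)"
proof -
  define c where "c k = expectation (\<lambda>\<omega>. (Y k \<omega>)\<^sup>2) * expectation (\<lambda>\<omega>. (v (Suc k) \<omega>)\<^sup>2)" for k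
  have c0: "0 \<le> c k" for k unfolding c_def by (intro mult_nonneg_nonneg integral_nonneg) auto
  have [measurable]: "transform Y n \<in> borel_measurable M" for n
    using measurable_F_M[OF transform_measurable] Y(1) by auto
  have tailN: "prob {\<omega> \<in> space M. \<exists>n. m \<le> n \<and> n \<le> N \<and> e \<le> \<bar>transform Y n \<omega> - transform Y m \<omega>\<bar>} \<le> (\<Sum>k. c (k + m)) / e\<^sup>2"
    if e: "e > 0" for m N e
  proof -
    define Z where "Z k = (if k < m then (\<lambda>_. 0) else Y k)" for k
    have Z: "Z k \<in> borel_measurable (F k)" "integrable M (\<lambda>\<omega>. (Z k \<omega>)\<^sup>2)" for k
      using Y by (auto simp: Z_def)
    have tZ: "transform Z n \<omega> = transform Y n \<omega> - transform Y m \<omega>" if "m \<le> n" for n \<omega>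
    proof -
      have "transform Y n \<omega> - transform Y m \<omega> = (\<Sum>k\<in>{..<n} - {..<m}. Y k \<omega> * v (Suc k) \<omega>)"
        unfolding transform_def using that by (subst sum_diff) auto
      also have "\<dots> = transform Z n \<omega>"
        unfolding transform_def by (intro sum.mono_neutral_cong_left) (auto simp: Z_def)
      finally show ?thesis by simp
    qed
    have "prob {\<omega> \<in> space M. \<exists>n. m \<le> n \<and> n \<le> N \<and> e \<le> \<bar>transform Y n \<omega> - transform Y m \<omega>\<bar>}
        \<le> prob {\<omega> \<in> space M. \<exists>n\<le>N. e \<le> \<bar>transform Z n \<omega>\<bar>}"
    proof (rule finite_measure_mono)
      show "{\<omega> \<in> space M. \<exists>n. m \<le> n \<and> n \<le> N \<and> e \<le> \<bar>transform Y n \<omega> - transform Y m \<omega>\<bar>}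
        \<subseteq> {\<omega> \<in> space M. \<exists>n\<le>N. e \<le> \<bar>transform Z n \<omega>\<bar>}"
        using tZ by fastforce
      have [measurable]: "transform Z n \<in> borel_measurable M" for n
        using measurable_F_M[OF transform_measurable] Z(1) by auto
      show "{\<omega> \<in> space M. \<exists>n\<le>N. e \<le> \<bar>transform Z n \<omega>\<bar>} \<in> events" by measurable
    qed
    also have "\<dots> \<le> (\<Sum>k<N. expectation (\<lambda>\<omega>. (Z k \<omega>)\<^sup>2) * expectation (\<lambda>\<omega>. (v (Suc k) \<omega>)\<^sup>2)) / e\<^sup>2"
      by (rule kolmogorov_inequality[OF Z e])
    also have "(\<Sum>k<N. expectation (\<lambda>\<omega>. (Z k \<omega>)\<^sup>2) * expectation (\<lambda>\<omega>. (v (Suc k) \<omega>)\<^sup>2)) = (\<Sum>k\<in>{m..<N}. c k)"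
      by (rule sum.mono_neutral_cong_right) (auto simp: Z_def c_def)
    also have "\<dots> = (\<Sum>k<N - m. c (k + m))"
      by (rule sum.reindex_bij_witness[of _ "\<lambda>k. k + m" "\<lambda>k. k - m"]) auto
    also have "\<dots> \<le> (\<Sum>k. c (k + m))"
      using summable_ignore_initial_segment[OF sm] c0 unfolding c_def by (intro sum_le_suminf) auto
    finally show ?thesis using e by (simp add: divide_right_mono)
  qed
  have tail: "prob {\<omega> \<in> space M. \<exists>n\<ge>m. e \<le> \<bar>transform Y n \<omega> - transform Y m \<omega>\<bar>} \<le> (\<Sum>k. c (k + m)) / e\<^sup>2"
    if e: "e > 0" for m e
  proof -
    let ?A = "\<lambda>N. {\<omega> \<in> space M. \<exists>n. m \<le> n \<and> n \<le> N \<and> e \<le> \<bar>transform Y n \<omega> - transform Y m \<omega>\<bar>}"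
    have "(\<lambda>N. prob (?A N)) \<longlonglongrightarrow> prob (\<Union>N. ?A N)"
    proof (rule finite_Lim_measure_incseq)
      have "?A N \<in> events" for N by measurable
      then show "range ?A \<subseteq> events" by blast
      show "incseq ?A" unfolding incseq_def using order_trans by blast
    qed
    also have "(\<Union>N. ?A N) = {\<omega> \<in> space M. \<exists>n\<ge>m. e \<le> \<bar>transform Y n \<omega> - transform Y m \<omega>\<bar>}" by auto
    finally show ?thesis using tailN[OF e] by (intro LIMSEQ_le_const2) auto
  qed
  have osc: "AE \<omega> in M. \<exists>m. \<forall>n\<ge>m. \<bar>transform Y n \<omega> - transform Y m \<omega>\<bar> < e" if e: "e > 0" for e
  proof -
    define B where "B = {\<omega> \<in> space M. \<forall>m. \<exists>n\<ge>m. e \<le> \<bar>transform Y n \<omega> - transform Y m \<omega>\<bar>}"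
    have B: "B \<in> events" unfolding B_def by measurable
    have "prob B \<le> (\<Sum>k. c (k + m)) / e\<^sup>2" for m
    proof -
      have "prob B \<le> prob {\<omega> \<in> space M. \<exists>n\<ge>m. e \<le> \<bar>transform Y n \<omega> - transform Y m \<omega>\<bar>}"
      proof (rule finite_measure_mono)
        show "{\<omega> \<in> space M. \<exists>n\<ge>m. e \<le> \<bar>transform Y n \<omega> - transform Y m \<omega>\<bar>} \<in> events" by measurable
      qed (auto simp: B_def)
      then show ?thesis using tail[OF e, of m] by simp
    qed
    moreover have "(\<lambda>m. (\<Sum>k. c (k + m)) / e\<^sup>2) \<longlonglongrightarrow> 0 / e\<^sup>2"
      using suminf_exist_split2[OF sm] e unfolding c_def by (intro tendsto_intros) auto
    ultimately have "prob B \<le> 0" by (intro LIMSEQ_le_const) auto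
    then have "emeasure M B = 0" using measure_nonneg[of M B] by (simp add: emeasure_eq_measure)
    then show ?thesis using B by (intro AE_I[where N = B]) (auto simp: B_def not_less)
  qed
  have "AE \<omega> in M. \<forall>j::nat. \<exists>m. \<forall>n\<ge>m. \<bar>transform Y n \<omega> - transform Y m \<omega>\<bar> < 1 / real (Suc j)"
    unfolding AE_all_countable using osc by simp
  then show ?thesis
  proof (rule AE_mp, intro AE_I2 impI)
    fix \<omega> assume *: "\<forall>j::nat. \<exists>m. \<forall>n\<ge>m. \<bar>transform Y n \<omega> - transform Y m \<omega>\<bar> < 1 / real (Suc j)"
    have "Cauchy (\<lambda>N. transform Y N \<omega>)"
      unfolding Cauchy_altdef2
    proof safe
      fix e :: real assume "e > 0"
      then obtain j where j: "1 / real (Suc j) < e" using nat_approx_posE by metis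
      from * obtain m where "\<And>n. n \<ge> m \<Longrightarrow> \<bar>transform Y n \<omega> - transform Y m \<omega>\<bar> < 1 / real (Suc j)"
        by blast
      then show "\<exists>N. \<forall>n\<ge>N. dist (transform Y n \<omega>) (transform Y N \<omega>) < e"
        using j by (auto simp: dist_real_def intro: less_trans)
    qed
    then show "convergent (\<lambda>N. transform Y N \<omega>)" by (rule Cauchy_convergent)
  qed
qed

end
section \<open>Random perturbations of a fixed operator\<close>

text \<open>The strict past and the next variable are functions of disjoint blocks of an independent family.\<close>
lemma (in prob_space) centered_noise_natural_filtration:
  fixes v :: "nat \<Rightarrow> 'a \<Rightarrow> real"
  assumes ind: "indep_vars (\<lambda>_. borel) v {1..}"
    and int: "\<And>n. n \<ge> 1 \<Longrightarrow> expectation (v n) = 0" "\<And>n. n \<ge> 1 \<Longrightarrow> integrable M (\<lambda>\<omega>. (v n \<omega>)\<^sup>2)"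
  shows "centered_noise M
    (\<lambda>n. vimage_algebra (space M) (\<lambda>\<omega>. restrict (\<lambda>i. v i \<omega>) {1..n}) (PiM {1..n} (\<lambda>_. borel))) v"
proof -
  define past where "past n = (\<lambda>\<omega>. restrict (\<lambda>i. v i \<omega>) {1..n})" for n
  define F where "F n = vimage_algebra (space M) (past n) (PiM {1..n} (\<lambda>_. borel :: real measure))" for n
  have vm: "v n \<in> borel_measurable M" if "n \<ge> 1" for n
    using ind that by (auto simp: indep_vars_def)
  have past_M: "past n \<in> measurable M (PiM {1..n} (\<lambda>_. borel))" for n
    unfolding past_def by (intro measurable_restrict vm) auto
  have space_F: "space (F n) = space M" for n by (simp add: F_def)
  have past_space: "past n \<in> space M \<rightarrow> space (PiM {1..n} (\<lambda>_. borel))" for n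
    using measurable_space[OF past_M] by auto
  have sets_F: "sets (F n) = {past n -` A \<inter> space M | A. A \<in> sets (PiM {1..n} (\<lambda>_. borel))}" for n
    unfolding F_def by (rule sets_vimage_algebra2[OF past_space])
  have past_F: "past n \<in> measurable (F n) (PiM {1..n} (\<lambda>_. borel))" for n
    unfolding F_def by (rule measurable_vimage_algebra1[OF past_space])
  have v_F: "v k \<in> borel_measurable (F n)" if "k \<in> {1..n}" for k n
    using measurable_compose[OF past_F measurable_component_singleton[OF that]] that
    by (simp add: past_def)
  have "centered_noise M F v"
  proof
    show "subalgebra M (F n)" for n
      using measurable_sets[OF past_M] by (auto simp: subalgebra_def space_F sets_F)
    show "sets (F m) \<subseteq> sets (F n)" if "m \<le> n" for m n
    proof -
      have "past m \<in> measurable (F n) (PiM {1..m} (\<lambda>_. borel))"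
        unfolding past_def using that by (intro measurable_restrict v_F) auto
      from measurable_sets[OF this] show ?thesis
        unfolding sets_F[of m] space_F by auto
    qed
    show "v (Suc n) \<in> borel_measurable (F (Suc n))" for n by (rule v_F) auto
    show "expectation (v (Suc n)) = 0" "integrable M (\<lambda>\<omega>. (v (Suc n) \<omega>)\<^sup>2)" for n
      using int by auto
    fix n and X :: "'a \<Rightarrow> real"
    assume X: "X \<in> borel_measurable (F n)"
    have XM: "X \<in> borel_measurable M"
      using measurable_from_subalg[OF \<open>subalgebra M (F n)\<close> X] .
    define next_v where "next_v = (\<lambda>\<omega>. restrict (\<lambda>i. v i \<omega>) {Suc n})"
    have "indep_var (PiM {1..n} (\<lambda>_. borel)) (past n) (PiM {Suc n} (\<lambda>_. borel)) next_v"
      unfolding past_def next_v_def by (rule indep_var_restrict[OF ind]) auto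
    then have set: "indep_set (sigma_sets (space M) {past n -` A \<inter> space M | A. A \<in> sets (PiM {1..n} (\<lambda>_. borel))})
        (sigma_sets (space M) {next_v -` A \<inter> space M | A. A \<in> sets (PiM {Suc n} (\<lambda>_. borel))})"
      unfolding indep_var_eq by blast
    have X_sets: "X -` A \<inter> space M \<in> {past n -` A \<inter> space M | A. A \<in> sets (PiM {1..n} (\<lambda>_. borel))}"
      if "A \<in> sets borel" for A
      using measurable_sets[OF X that] unfolding sets_F[symmetric] space_F .
    have v_sets: "v (Suc n) -` A \<inter> space M \<in> {next_v -` A \<inter> space M | A. A \<in> sets (PiM {Suc n} (\<lambda>_. borel))}"
      if "A \<in> sets borel" for A
    proof -
      have "(\<lambda>x. x (Suc n)) \<in> measurable (PiM {Suc n} (\<lambda>_. borel :: real measure)) borel"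
        by (rule measurable_component_singleton) simp
      from measurable_sets[OF this that]
      have "(\<lambda>x. x (Suc n)) -` A \<inter> space (PiM {Suc n} (\<lambda>_. borel :: real measure)) \<in> sets (PiM {Suc n} (\<lambda>_. borel))" .
      moreover have "v (Suc n) -` A \<inter> space M
          = next_v -` ((\<lambda>x. x (Suc n)) -` A \<inter> space (PiM {Suc n} (\<lambda>_. borel :: real measure))) \<inter> space M"
        by (auto simp: next_v_def space_PiM)
      ultimately show ?thesis by blast
    qed
    show "indep_var borel X borel (v (Suc n))"
      unfolding indep_var_eq
    proof (intro conjI XM vm indep_setI)
      note le = sigma_sets_mono[of "{X -` A \<inter> space M | A. A \<in> sets borel}" "space M"
          "{past n -` A \<inter> space M | A. A \<in> sets (PiM {1..n} (\<lambda>_. borel))}"]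
        sigma_sets_mono[of "{v (Suc n) -` A \<inter> space M | A. A \<in> sets borel}" "space M"
          "{next_v -` A \<inter> space M | A. A \<in> sets (PiM {Suc n} (\<lambda>_. borel))}"]
      have 1: "sigma_sets (space M) {X -` A \<inter> space M | A. A \<in> sets borel}
          \<subseteq> sigma_sets (space M) {past n -` A \<inter> space M | A. A \<in> sets (PiM {1..n} (\<lambda>_. borel))}"
        using X_sets by (intro le) auto
      have 2: "sigma_sets (space M) {v (Suc n) -` A \<inter> space M | A. A \<in> sets borel}
          \<subseteq> sigma_sets (space M) {next_v -` A \<inter> space M | A. A \<in> sets (PiM {Suc n} (\<lambda>_. borel))}"
        using v_sets by (intro le) auto
      show "sigma_sets (space M) {X -` A \<inter> space M | A. A \<in> sets borel} \<subseteq> events"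
        using XM by (intro sets.sigma_sets_subset) auto
      show "sigma_sets (space M) {v (Suc n) -` A \<inter> space M | A. A \<in> sets borel} \<subseteq> events"
        using vm[of "Suc n"] by (intro sets.sigma_sets_subset) auto
      fix a c
      assume "a \<in> sigma_sets (space M) {X -` A \<inter> space M | A. A \<in> sets borel}"
        and "c \<in> sigma_sets (space M) {v (Suc n) -` A \<inter> space M | A. A \<in> sets borel}"
      then show "prob (a \<inter> c) = prob a * prob c"
        using 1 2 indep_setD[OF set] by blast
    qed auto
  qed
  then show ?thesis unfolding F_def[abs_def] past_def .
qed

lemma borel_measurable_phi1:
  fixes w :: "nat \<Rightarrow> 'a \<Rightarrow> real" and e \<tau> :: "'a \<Rightarrow> real"
  assumes [measurable]: "e \<in> borel_measurable M" "\<tau> \<in> borel_measurable M"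
    and w: "\<And>n. 1 \<le> n \<Longrightarrow> n < N \<Longrightarrow> w n \<in> borel_measurable M"
  shows "n \<le> N \<Longrightarrow> (\<lambda>x. phi1 (\<lambda>n. w n x) (e x) (\<tau> x) n) \<in> borel_measurable M"
proof (induction n rule: induct_nat_012)
  case (ge2 n)
  then have [measurable]: "(\<lambda>x. phi1 (\<lambda>n. w n x) (e x) (\<tau> x) n) \<in> borel_measurable M"
    "(\<lambda>x. phi1 (\<lambda>n. w n x) (e x) (\<tau> x) (Suc n)) \<in> borel_measurable M"
    "w (Suc n) \<in> borel_measurable M"
    using w by auto
  show ?case by simp
qed auto

context centered_noise
begin

text \<open>
  The recursion reads the potential at a site one step late: the solution at \<open>k + 1\<close> depends on the
  potential at \<open>1, \<dots>, k\<close> only. This is what makes the coordinates a martingale.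
\<close>
lemma perturbed_phi1_measurable:
  "n \<le> Suc k \<Longrightarrow> (\<lambda>\<omega>. phi1 (\<lambda>n. b n + v n \<omega>) E \<tau> n) \<in> borel_measurable (F k)"
proof (rule borel_measurable_phi1[where N = "Suc k"])
  fix n assume "1 \<le> n" "n < Suc k"
  then obtain m where "n = Suc m" "Suc m \<le> k" by (cases n) auto
  then show "(\<lambda>\<omega>. b n + v n \<omega>) \<in> borel_measurable (F k)"
    using measurable_F_mono[OF adapted[of m]] by simp
qed auto

text \<open>
  Expanding the squares in the recursion for the coordinates, the mixed terms have mean zero and the
  rest multiplies their second moment by at most \<open>1 + \<langle>v\<^sup>2\<rangle> (f\<^sup>2 + g\<^sup>2)\<^sup>2\<close>; the product of these
  factors converges. The solution is the combination of \<open>f\<close> and \<open>g\<close> with these coordinates.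
\<close>
lemma perturbed_solution_second_moment:
  fixes b :: "nat \<Rightarrow> real" and E \<theta> \<tau> :: real
  defines "f \<equiv> phi1 b E \<theta>" and "g \<equiv> phi2 b E \<theta>"
    and "U \<equiv> \<lambda>n \<omega>. phi1 (\<lambda>n. b n + v n \<omega>) E \<tau> n"
    and "a \<equiv> \<lambda>n \<omega>. wronskian (phi1 (\<lambda>n. b n + v n \<omega>) E \<tau>) (phi2 b E \<theta>) n"
    and "c \<equiv> \<lambda>n \<omega>. wronskian (phi1 b E \<theta>) (phi1 (\<lambda>n. b n + v n \<omega>) E \<tau>) n"
  assumes sm: "summable (\<lambda>k. expectation (\<lambda>\<omega>. (v (Suc k) \<omega>)\<^sup>2) * ((f (Suc k))\<^sup>2 + (g (Suc k))\<^sup>2)\<^sup>2)"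
  shows "\<exists>B\<ge>0. \<forall>n. integrable M (\<lambda>\<omega>. (U (Suc n) \<omega>)\<^sup>2) \<and>
      expectation (\<lambda>\<omega>. (U (Suc n) \<omega>)\<^sup>2) \<le> ((f (Suc n))\<^sup>2 + (g (Suc n))\<^sup>2) * B"
proof -
  define \<sigma> where "\<sigma> k = expectation (\<lambda>\<omega>. (v (Suc k) \<omega>)\<^sup>2)" for k
  define m where "m k = (f (Suc k))\<^sup>2 + (g (Suc k))\<^sup>2" for k
  have \<sigma>: "0 \<le> \<sigma> k" for k unfolding \<sigma>_def by simp
  have m: "0 \<le> m k" for k unfolding m_def by simp
  have W: "wronskian f g n = 1" for n unfolding f_def g_def by (rule wronskian_phi)
  have Um: "U n \<in> borel_measurable (F k)" if "n \<le> Suc k" for n k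
    unfolding U_def using that by (rule perturbed_phi1_measurable)
  have am: "a n \<in> borel_measurable (F n)" and cm: "c n \<in> borel_measurable (F n)" for n
    using Um[of "Suc n" n] Um[of n n] unfolding a_def c_def wronskian_def U_def by measurable
  have a_Suc: "a (Suc n) \<omega> = a n \<omega> + (- (g (Suc n)) * U (Suc n) \<omega>) * v (Suc n) \<omega>" for n \<omega>
    using wronskian_perturbed_Suc[OF is_solution_phi1 is_solution_phi2, of b "\<lambda>n. v n \<omega>" E \<tau> \<theta> n]
    unfolding a_def g_def U_def by simp
  have c_Suc: "c (Suc n) \<omega> = c n \<omega> + (f (Suc n) * U (Suc n) \<omega>) * v (Suc n) \<omega>" for n \<omega>
    using wronskian_perturbed_Suc[OF is_solution_phi1 is_solution_phi1, of b "\<lambda>n. v n \<omega>" E \<tau> \<theta> n]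
      wronskian_swap[of "phi1 b E \<theta>" "phi1 (\<lambda>n. b n + v n \<omega>) E \<tau>"]
    unfolding c_def f_def U_def by simp
  have U_expand: "U (Suc n) \<omega> = f (Suc n) * a n \<omega> + g (Suc n) * c n \<omega>" for n \<omega>
    using wronskian_expand(2)[OF W[unfolded f_def g_def], of "phi1 (\<lambda>n. b n + v n \<omega>) E \<tau>" n]
    unfolding U_def a_def c_def f_def g_def by (simp add: mult.commute)
  have lin: "integrable M (\<lambda>\<omega>. (x * X \<omega>)\<^sup>2)" if "integrable M (\<lambda>\<omega>. (X \<omega>)\<^sup>2)" for x and X :: "'a \<Rightarrow> real"
    using that by (simp add: power_mult_distrib)
  have U2: "integrable M (\<lambda>\<omega>. (U (Suc n) \<omega>)\<^sup>2)"
    if "integrable M (\<lambda>\<omega>. (a n \<omega>)\<^sup>2)" "integrable M (\<lambda>\<omega>. (c n \<omega>)\<^sup>2)" for n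
  proof -
    have "integrable M (\<lambda>\<omega>. (f (Suc n) * a n \<omega> + g (Suc n) * c n \<omega>)\<^sup>2)"
      by (intro integrable_square_add lin that borel_measurable_times borel_measurable_const
          measurable_F_M[OF am] measurable_F_M[OF cm])
    then show ?thesis by (simp add: U_expand)
  qed
  have step: "integrable M (\<lambda>\<omega>. (a (Suc n) \<omega>)\<^sup>2) \<and> integrable M (\<lambda>\<omega>. (c (Suc n) \<omega>)\<^sup>2) \<and>
      expectation (\<lambda>\<omega>. (a (Suc n) \<omega>)\<^sup>2 + (c (Suc n) \<omega>)\<^sup>2)
        = expectation (\<lambda>\<omega>. (a n \<omega>)\<^sup>2 + (c n \<omega>)\<^sup>2) + \<sigma> n * m n * expectation (\<lambda>\<omega>. (U (Suc n) \<omega>)\<^sup>2)"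
    if ac: "integrable M (\<lambda>\<omega>. (a n \<omega>)\<^sup>2)" "integrable M (\<lambda>\<omega>. (c n \<omega>)\<^sup>2)" for n
  proof -
    have key: "integrable M (\<lambda>\<omega>. (X \<omega> + (x * U (Suc n) \<omega>) * v (Suc n) \<omega>)\<^sup>2) \<and>
        expectation (\<lambda>\<omega>. (X \<omega> + (x * U (Suc n) \<omega>) * v (Suc n) \<omega>)\<^sup>2)
          = expectation (\<lambda>\<omega>. (X \<omega>)\<^sup>2) + x\<^sup>2 * expectation (\<lambda>\<omega>. (U (Suc n) \<omega>)\<^sup>2) * \<sigma> n"
      if X: "X \<in> borel_measurable (F n)" "integrable M (\<lambda>\<omega>. (X \<omega>)\<^sup>2)" for X x
    proof -
      have Y: "(\<lambda>\<omega>. x * U (Suc n) \<omega>) \<in> borel_measurable (F n)" using Um[of "Suc n" n] by simp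
      note Y2 = lin[OF U2[OF ac], of x]
      note [simp] = past_times_noise[OF Y Y2] noise_orthogonal_past[OF Y X(1) Y2 X(2)] X(2)
      have eq: "(X \<omega> + (x * U (Suc n) \<omega>) * v (Suc n) \<omega>)\<^sup>2 = (X \<omega>)\<^sup>2 + ((x * U (Suc n) \<omega>) * v (Suc n) \<omega>)\<^sup>2
          + 2 * (X \<omega> * ((x * U (Suc n) \<omega>) * v (Suc n) \<omega>))" for \<omega>
        by (simp add: power2_sum)
      show ?thesis
        unfolding eq by (simp add: \<sigma>_def) (simp add: power_mult_distrib)
    qed
    show ?thesis
      using key[OF am ac(1), of "- g (Suc n)"] key[OF cm ac(2), of "f (Suc n)"] ac
      unfolding a_Suc c_Suc by (simp add: m_def algebra_simps)
  qed
  have ac: "integrable M (\<lambda>\<omega>. (a n \<omega>)\<^sup>2) \<and> integrable M (\<lambda>\<omega>. (c n \<omega>)\<^sup>2)" for n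
  proof (induction n)
    case 0
    show ?case unfolding a_def c_def wronskian_def by simp
  next
    case (Suc n)
    then show ?case using step[of n] by simp
  qed
  define e where "e n = expectation (\<lambda>\<omega>. (a n \<omega>)\<^sup>2 + (c n \<omega>)\<^sup>2)" for n
  have e0: "0 \<le> e n" for n unfolding e_def by simp
  have EU: "expectation (\<lambda>\<omega>. (U (Suc n) \<omega>)\<^sup>2) \<le> m n * e n" for n
  proof -
    have "expectation (\<lambda>\<omega>. (U (Suc n) \<omega>)\<^sup>2) \<le> expectation (\<lambda>\<omega>. m n * ((a n \<omega>)\<^sup>2 + (c n \<omega>)\<^sup>2))"
    proof (rule integral_mono)
      show "integrable M (\<lambda>\<omega>. (U (Suc n) \<omega>)\<^sup>2)" using U2 ac by blast
      show "integrable M (\<lambda>\<omega>. m n * ((a n \<omega>)\<^sup>2 + (c n \<omega>)\<^sup>2))" using ac by simp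
      fix \<omega>
      have "(f (Suc n) * a n \<omega> + g (Suc n) * c n \<omega>)\<^sup>2 + (f (Suc n) * c n \<omega> - g (Suc n) * a n \<omega>)\<^sup>2
          = m n * ((a n \<omega>)\<^sup>2 + (c n \<omega>)\<^sup>2)"
        unfolding m_def by (simp add: power2_eq_square algebra_simps)
      then show "(U (Suc n) \<omega>)\<^sup>2 \<le> m n * ((a n \<omega>)\<^sup>2 + (c n \<omega>)\<^sup>2)"
        unfolding U_expand by (metis le_add_same_cancel1 zero_le_power2)
    qed
    then show ?thesis using ac by (simp add: e_def)
  qed
  have e_le: "e n \<le> e 0 * exp (\<Sum>k<n. \<sigma> k * (m k)\<^sup>2)" for n
  proof (induction n)
    case (Suc n)
    have "e (Suc n) = e n + \<sigma> n * m n * expectation (\<lambda>\<omega>. (U (Suc n) \<omega>)\<^sup>2)"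
      using step[of n] ac[of n] by (simp add: e_def)
    also have "\<dots> \<le> e n + \<sigma> n * m n * (m n * e n)"
      using EU[of n] \<sigma>[of n] m[of n] by (intro add_left_mono mult_left_mono) auto
    also have "\<dots> = e n * (1 + \<sigma> n * (m n)\<^sup>2)" by (simp add: power2_eq_square algebra_simps)
    also have "\<dots> \<le> (e 0 * exp (\<Sum>k<n. \<sigma> k * (m k)\<^sup>2)) * exp (\<sigma> n * (m n)\<^sup>2)"
      using Suc e0 \<sigma>[of n] by (intro mult_mono exp_ge_add_one_self) auto
    finally show ?case by (simp add: exp_add algebra_simps)
  qed simp
  define B where "B = e 0 * exp (\<Sum>k. \<sigma> k * (m k)\<^sup>2)"
  have "e n \<le> B" for n
  proof -
    have "(\<Sum>k<n. \<sigma> k * (m k)\<^sup>2) \<le> (\<Sum>k. \<sigma> k * (m k)\<^sup>2)"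
      using sm \<sigma> unfolding \<sigma>_def m_def by (intro sum_le_suminf) auto
    then have "e 0 * exp (\<Sum>k<n. \<sigma> k * (m k)\<^sup>2) \<le> B"
      unfolding B_def using e0 by (intro mult_left_mono) auto
    then show ?thesis using e_le[of n] by linarith
  qed
  then have "expectation (\<lambda>\<omega>. (U (Suc n) \<omega>)\<^sup>2) \<le> m n * B" for n
    using EU[of n] mult_left_mono[of "e n" B "m n"] m[of n] by (meson order_trans)
  moreover have "0 \<le> B" using e0 by (simp add: B_def)
  ultimately show ?thesis using U2 ac unfolding m_def by blast
qed

text \<open>
  Both series are transforms with factors \<open>x\<^sub>k u (k + 1)\<close>. As \<open>\<langle>u\<^sup>2\<rangle>\<close> is at most a constant times
  \<open>f\<^sup>2 + g\<^sup>2\<close>, it is enough to bound \<open>x\<^sup>2 (f\<^sup>2 + g\<^sup>2)\<close> by the weights. For the series with weight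
  \<open>n\<^bsup>q/2\<^esup>\<close> the mixed product \<open>n\<^bsup>q\<^esup> f\<^sup>2 g\<^sup>2\<close> is at most \<open>(n\<^bsup>2q\<^esup> f\<^sup>4 + g\<^sup>4) / 2\<close>; this is why \<open>q/2\<close>,
  and not \<open>q\<close>, is the exponent here.
\<close>
lemma AE_asymptotically_free:
  fixes b :: "nat \<Rightarrow> real" and E \<theta> q :: real
  defines "f \<equiv> phi1 b E \<theta>" and "g \<equiv> phi2 b E \<theta>"
  assumes q: "q > 0"
    and sm: "summable (\<lambda>k. (\<bar>f (Suc k)\<bar> ^ 4 * real (Suc k) powr (2 * q) + \<bar>g (Suc k)\<bar> ^ 4)
      * expectation (\<lambda>\<omega>. (v (Suc k) \<omega>)\<^sup>2))"
  shows "AE \<omega> in M. asymptotically_free (q / 2) b E \<theta> (\<lambda>n. v n \<omega>)"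
proof -
  define \<sigma> where "\<sigma> k = expectation (\<lambda>\<omega>. (v (Suc k) \<omega>)\<^sup>2)" for k
  define m where "m k = (f (Suc k))\<^sup>2 + (g (Suc k))\<^sup>2" for k
  define r where "r k = \<bar>f (Suc k)\<bar> ^ 4 * real (Suc k) powr (2 * q) + \<bar>g (Suc k)\<bar> ^ 4" for k
  have \<sigma>: "0 \<le> \<sigma> k" for k unfolding \<sigma>_def by simp
  have m: "0 \<le> m k" for k unfolding m_def by simp
  have bounds: "(m k)\<^sup>2 \<le> 2 * r k" "(real (Suc k) powr (q / 2) * f (Suc k))\<^sup>2 * m k \<le> 2 * r k" for k
  proof -
    define x where "x = real (Suc k) powr q"
    define A where "A = (f (Suc k))\<^sup>2"
    define D where "D = (g (Suc k))\<^sup>2"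
    have x: "1 \<le> x" unfolding x_def using q by (intro ge_one_powr_ge_zero) auto
    have r: "r k = (A * x)\<^sup>2 + D\<^sup>2"
    proof -
      have "x\<^sup>2 = real (Suc k) powr (2 * q)"
        unfolding x_def by (simp only: power2_eq_square powr_add[symmetric] mult_2)
      moreover have "\<bar>y\<bar> ^ 4 = (y\<^sup>2)\<^sup>2" for y :: real by simp
      ultimately show ?thesis unfolding r_def A_def D_def by (simp add: power_mult_distrib)
    qed
    have AD: "0 \<le> A" "0 \<le> D" by (auto simp: A_def D_def)
    have Ax: "A \<le> A * x" using AD x by (simp add: mult_le_cancel_left1)
    have "(A + D)\<^sup>2 \<le> 2 * (A\<^sup>2 + D\<^sup>2)"
      using sum_squares_bound[of A D] by (simp add: power2_sum)
    also have "\<dots> \<le> 2 * r k" unfolding r using Ax AD by (intro mult_left_mono add_right_mono power_mono) auto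
    finally show "(m k)\<^sup>2 \<le> 2 * r k" by (simp add: m_def A_def D_def)
    have "(real (Suc k) powr (q / 2))\<^sup>2 = x"
      unfolding x_def by (simp only: power2_eq_square powr_add[symmetric] field_sum_of_halves)
    then have "(real (Suc k) powr (q / 2) * f (Suc k))\<^sup>2 * m k = (A * x) * A + (A * x) * D"
      by (simp add: power_mult_distrib m_def A_def D_def algebra_simps)
    also have "\<dots> \<le> (A * x)\<^sup>2 + ((A * x)\<^sup>2 + D\<^sup>2)"
    proof (rule add_mono)
      show "A * x * A \<le> (A * x)\<^sup>2"
        unfolding power2_eq_square using Ax AD x by (intro mult_left_mono) auto
      have "2 * (A * x) * D \<le> (A * x)\<^sup>2 + D\<^sup>2" by (rule sum_squares_bound)
      moreover have "0 \<le> A * x * D" using AD x by simp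
      ultimately show "A * x * D \<le> (A * x)\<^sup>2 + D\<^sup>2" by simp
    qed
    also have "\<dots> \<le> 2 * r k" unfolding r using AD by simp
    finally show "(real (Suc k) powr (q / 2) * f (Suc k))\<^sup>2 * m k \<le> 2 * r k" .
  qed
  have sm_r: "summable (\<lambda>k. 2 * B * (r k * \<sigma> k))" for B
    using summable_mult[OF sm, of "2 * B"] by (simp add: r_def \<sigma>_def)
  have sm_m: "summable (\<lambda>k. \<sigma> k * (m k)\<^sup>2)"
  proof (rule summable_comparison_test'[OF sm_r[of 1]])
    show "norm (\<sigma> k * (m k)\<^sup>2) \<le> 2 * 1 * (r k * \<sigma> k)" for k
      using mult_right_mono[OF bounds(1) \<sigma>, of k k] \<sigma>[of k] by (simp add: mult.commute)
  qed
  have main: "AE \<omega> in M. convergent (wronskian (phi1 (\<lambda>n. b n + v n \<omega>) E \<tau>) g) \<and>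
      convergent (\<lambda>N. \<Sum>k=1..N. real k powr (q / 2) * (v k \<omega> * phi1 (\<lambda>n. b n + v n \<omega>) E \<tau> k * f k))" for \<tau>
  proof -
    define U where "U n \<omega> = phi1 (\<lambda>n. b n + v n \<omega>) E \<tau> n" for n \<omega>
    have Um: "U (Suc k) \<in> borel_measurable (F k)" for k
      unfolding U_def by (rule perturbed_phi1_measurable) simp
    obtain B where B: "0 \<le> B" "\<And>n. integrable M (\<lambda>\<omega>. (U (Suc n) \<omega>)\<^sup>2)"
        "\<And>n. expectation (\<lambda>\<omega>. (U (Suc n) \<omega>)\<^sup>2) \<le> m n * B"
      using perturbed_solution_second_moment[of b E \<theta> \<tau>] sm_m
      unfolding U_def m_def f_def g_def \<sigma>_def by blast
    have conv: "AE \<omega> in M. convergent (\<lambda>N. transform (\<lambda>k \<omega>. x k * U (Suc k) \<omega>) N \<omega>)"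
      if x: "\<And>k. (x k)\<^sup>2 * m k \<le> 2 * r k" for x
    proof (rule transform_converges)
      show "(\<lambda>\<omega>. x k * U (Suc k) \<omega>) \<in> borel_measurable (F k)" for k using Um[of k] by simp
      show "integrable M (\<lambda>\<omega>. (x k * U (Suc k) \<omega>)\<^sup>2)" for k
        using B(2) by (simp add: power_mult_distrib)
      show "summable (\<lambda>k. expectation (\<lambda>\<omega>. (x k * U (Suc k) \<omega>)\<^sup>2) * expectation (\<lambda>\<omega>. (v (Suc k) \<omega>)\<^sup>2))"
      proof (rule summable_comparison_test'[OF sm_r[of B]])
        fix k
        have "expectation (\<lambda>\<omega>. (x k * U (Suc k) \<omega>)\<^sup>2) = (x k)\<^sup>2 * expectation (\<lambda>\<omega>. (U (Suc k) \<omega>)\<^sup>2)"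
          by (simp add: power_mult_distrib)
        also have "\<dots> \<le> (x k)\<^sup>2 * (m k * B)" using B(3) by (intro mult_left_mono) auto
        also have "\<dots> \<le> 2 * r k * B" using mult_right_mono[OF x B(1), of k] by (simp add: mult.assoc)
        finally have "expectation (\<lambda>\<omega>. (x k * U (Suc k) \<omega>)\<^sup>2) * \<sigma> k \<le> 2 * r k * B * \<sigma> k"
          using \<sigma> by (intro mult_right_mono)
        moreover have "0 \<le> expectation (\<lambda>\<omega>. (x k * U (Suc k) \<omega>)\<^sup>2) * \<sigma> k"
          using \<sigma> by (intro mult_nonneg_nonneg integral_nonneg) auto
        ultimately show "norm (expectation (\<lambda>\<omega>. (x k * U (Suc k) \<omega>)\<^sup>2) * expectation (\<lambda>\<omega>. (v (Suc k) \<omega>)\<^sup>2))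
            \<le> 2 * B * (r k * \<sigma> k)"
          by (simp add: \<sigma>_def algebra_simps)
      qed
    qed
    have "(g (Suc k))\<^sup>2 * m k \<le> 2 * r k" for k
    proof -
      have "(g (Suc k))\<^sup>2 * m k \<le> m k * m k" using m by (intro mult_right_mono) (auto simp: m_def)
      then show ?thesis using bounds(1)[of k] by (simp add: power2_eq_square)
    qed
    from conv[of "\<lambda>k. g (Suc k)", OF this]
      conv[of "\<lambda>k. real (Suc k) powr (q / 2) * f (Suc k)", OF bounds(2)]
    show ?thesis
    proof eventually_elim
      case (elim \<omega>)
      let ?u = "phi1 (\<lambda>n. b n + v n \<omega>) E \<tau>"
      have eq: "wronskian ?u g n = wronskian ?u g 0 - transform (\<lambda>k \<omega>. g (Suc k) * U (Suc k) \<omega>) n \<omega>" for n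
        unfolding transform_def g_def U_def
        by (induction n) (simp_all add: wronskian_perturbed_Suc[OF is_solution_phi1 is_solution_phi2])
      have 1: "convergent (wronskian ?u g)"
        using convergent_diff[OF convergent_const[of "wronskian ?u g 0"] elim(1)]
        unfolding eq[symmetric] .
      have "(\<lambda>N. \<Sum>k=1..N. real k powr (q / 2) * (v k \<omega> * ?u k * f k))
          = (\<lambda>N. transform (\<lambda>k \<omega>. real (Suc k) powr (q / 2) * f (Suc k) * U (Suc k) \<omega>) N \<omega>)"
        unfolding transform_def U_def by (simp add: sum.atLeast1_atMost_eq mult_ac)
      then show ?case using 1 elim(2) by simp
    qed
  qed
  show ?thesis
    using main[of \<theta>] main[of "\<theta> - pi / 2"]
    unfolding asymptotically_free_def f_def g_def by eventually_elim simp
qed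

end

section \<open>Measurability in the energy and exchange of null sets\<close>

text \<open>
  For \<open>\<tau> \<in> {-\<pi>/2, 0}\<close> these are entries of the Gram matrix of the solutions with initial angles
  \<open>-\<pi>/2\<close> and \<open>0\<close>, divided by its trace.
\<close>
definition gram_ratio :: "(nat \<Rightarrow> real) \<Rightarrow> real \<Rightarrow> real \<Rightarrow> nat \<Rightarrow> real" where
  "gram_ratio b E \<tau> N =
     (\<Sum>n=1..N. phi1 b E (- pi / 2) n * phi1 b E \<tau> n) /
     (\<Sum>n=1..N. (phi1 b E 0 n)\<^sup>2 + (phi1 b E (- pi / 2) n)\<^sup>2)"

text \<open>
  The entries tend to \<open>cos\<^sup>2 \<theta>\<close> and \<open>sin \<theta> cos \<theta>\<close> for the subordinate angle \<open>\<theta>\<close>. The case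
  \<open>cos \<theta> = 0\<close> belongs to the left end point of the interval of admissible angles.
\<close>
definition limit_angle :: "(nat \<Rightarrow> real) \<Rightarrow> real \<Rightarrow> real" where
  "limit_angle b E =
     (if lim (gram_ratio b E (- pi / 2)) = 0 then - pi / 2
      else arctan (lim (gram_ratio b E 0) / lim (gram_ratio b E (- pi / 2))))"

lemma borel_measurable_limit_angle: "limit_angle b \<in> borel_measurable borel"
proof -
  have phi [measurable]: "(\<lambda>E. phi1 b E \<tau> n) \<in> borel_measurable borel" for \<tau> n
    by (rule borel_measurable_phi1[where N = n and w = "\<lambda>n _. b n"]) auto
  have gr [measurable]: "(\<lambda>E. gram_ratio b E \<tau> N) \<in> borel_measurable borel" for \<tau> N
    unfolding gram_ratio_def by measurable
  have [measurable]: "(\<lambda>E. lim (gram_ratio b E \<tau>)) \<in> borel_measurable borel" for \<tau>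
    using borel_measurable_lim_metric[OF gr[of \<tau>]] by simp
  show ?thesis unfolding limit_angle_def[abs_def] by measurable
qed

text \<open>
  In the basis of the subordinate and the complementary solution the Gram matrix, divided by its trace,
  tends to the projection onto the second vector: one diagonal entry dominates, and the off-diagonal
  entry is negligible by the Cauchy-Schwarz inequality. Rotating the basis gives the limits in
  terms of \<open>\<theta>\<close>.
\<close>
lemma limit_angle_eq_theta:
  assumes "has_theta b E"
  shows "limit_angle b E = theta b E"
proof -
  define \<theta> where "\<theta> = theta b E"
  define f where "f = phi1 b E \<theta>"
  define g where "g = phi2 b E \<theta>"
  have \<theta>: "\<theta> \<in> {- pi / 2..<pi / 2}" and sub: "subordinate b E \<theta>"
    using theta_props[OF assms] by (simp_all add: \<theta>_def)
  define A where "A N = (\<Sum>n=1..N. (f n)\<^sup>2)" for N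
  define D where "D N = (\<Sum>n=1..N. (g n)\<^sup>2)" for N
  define H where "H N = (\<Sum>n=1..N. f n * g n)" for N
  have A: "0 \<le> A N" for N unfolding A_def by (intro sum_nonneg) auto
  have D: "0 < D N" if "N \<ge> 2" for N
    using norm_upto_phi2_pos[of "real N" b E \<theta>] that
    by (simp add: norm_upto_of_nat D_def g_def)
  have H: "(H N)\<^sup>2 \<le> A N * D N" for N
    unfolding A_def D_def H_def by (rule Cauchy_Schwarz_ineq_sum)
  have "(\<lambda>N. (norm_upto f (real N) / norm_upto g (real N))\<^sup>2) \<longlonglongrightarrow> 0\<^sup>2"
    using filterlim_compose[OF sub[unfolded subordinate_def] filterlim_real_sequentially]
    unfolding f_def g_def by (intro tendsto_power)
  moreover have "(norm_upto f (real N) / norm_upto g (real N))\<^sup>2 = A N / D N" for N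
    by (simp add: norm_upto_of_nat A_def D_def power_divide sum_nonneg)
  ultimately have ratio: "(\<lambda>N. A N / D N) \<longlonglongrightarrow> 0" by simp
  define x where "x N = A N / (A N + D N)" for N
  define y where "y N = D N / (A N + D N)" for N
  define z where "z N = H N / (A N + D N)" for N
  have ev: "\<forall>\<^sub>F N in sequentially. (2::nat) \<le> N" by (rule eventually_ge_at_top)
  have x: "x \<longlonglongrightarrow> 0"
  proof (rule Lim_null_comparison[OF _ ratio])
    show "\<forall>\<^sub>F N in sequentially. norm (x N) \<le> A N / D N"
      using ev
    proof eventually_elim
      case (elim N)
      then show ?case using A[of N] D[of N] unfolding x_def by (simp add: frac_le)
    qed
  qed
  have y: "y \<longlonglongrightarrow> 1"
  proof (rule Lim_transform_eventually)
    show "(\<lambda>N. 1 - x N) \<longlonglongrightarrow> 1" using tendsto_diff[OF tendsto_const x, of 1] by simp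
    show "\<forall>\<^sub>F N in sequentially. 1 - x N = y N"
      using ev
    proof eventually_elim
      case (elim N)
      then show ?case using A[of N] D[of N] unfolding x_def y_def by (simp add: field_simps)
    qed
  qed
  have z: "z \<longlonglongrightarrow> 0"
  proof (rule Lim_null_comparison)
    show "(\<lambda>N. sqrt (x N * y N)) \<longlonglongrightarrow> 0"
      using tendsto_real_sqrt[OF tendsto_mult[OF x y]] by simp
    show "\<forall>\<^sub>F N in sequentially. norm (z N) \<le> sqrt (x N * y N)"
    proof (intro always_eventually allI)
      fix N
      have "(z N)\<^sup>2 = (H N)\<^sup>2 / (A N + D N)\<^sup>2" by (simp add: z_def power_divide)
      also have "\<dots> \<le> (A N * D N) / (A N + D N)\<^sup>2" by (rule divide_right_mono[OF H]) simp
      also have "\<dots> = x N * y N" by (simp add: x_def y_def power2_eq_square)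
      finally show "norm (z N) \<le> sqrt (x N * y N)" by (simp add: real_le_rsqrt)
    qed
  qed
  have c_eq: "phi1 b E 0 n = cos \<theta> * f n + sin \<theta> * g n" for n
    using phi1_rotate[of b E 0 \<theta>] by (simp add: f_def g_def)
  have s_eq: "phi1 b E (- pi / 2) n = - sin \<theta> * f n + cos \<theta> * g n" for n
  proof -
    have "cos (- pi / 2 - \<theta>) = - sin \<theta>" "sin (- pi / 2 - \<theta>) = - cos \<theta>"
      by (simp_all add: cos_diff sin_diff)
    then show ?thesis using phi1_rotate[of b E "- pi / 2" \<theta>] by (simp add: f_def g_def)
  qed
  have tr: "(\<Sum>n=1..N. (phi1 b E 0 n)\<^sup>2 + (phi1 b E (- pi / 2) n)\<^sup>2) = A N + D N" for N
  proof -
    have "(phi1 b E 0 n)\<^sup>2 + (phi1 b E (- pi / 2) n)\<^sup>2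
        = ((sin \<theta>)\<^sup>2 + (cos \<theta>)\<^sup>2) * ((f n)\<^sup>2 + (g n)\<^sup>2)" for n
      unfolding c_eq s_eq by algebra
    then show ?thesis by (simp add: A_def D_def sum.distrib)
  qed
  have "gram_ratio b E (- pi / 2)
      = (\<lambda>N. (sin \<theta>)\<^sup>2 * x N + (cos \<theta>)\<^sup>2 * y N - 2 * sin \<theta> * cos \<theta> * z N)"
  proof
    fix N
    have "(\<Sum>n=1..N. phi1 b E (- pi / 2) n * phi1 b E (- pi / 2) n)
        = (\<Sum>n=1..N. (sin \<theta>)\<^sup>2 * (f n)\<^sup>2 + (cos \<theta>)\<^sup>2 * (g n)\<^sup>2 + (- 2 * sin \<theta> * cos \<theta>) * (f n * g n))"
      unfolding s_eq by (rule sum.cong) (simp_all add: power2_eq_square algebra_simps)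
    also have "\<dots> = (sin \<theta>)\<^sup>2 * A N + (cos \<theta>)\<^sup>2 * D N + (- 2 * sin \<theta> * cos \<theta>) * H N"
      by (simp only: A_def D_def H_def sum.distrib sum_distrib_left)
    finally show "gram_ratio b E (- pi / 2) N
        = (sin \<theta>)\<^sup>2 * x N + (cos \<theta>)\<^sup>2 * y N - 2 * sin \<theta> * cos \<theta> * z N"
      unfolding gram_ratio_def tr x_def y_def z_def by (simp add: add_divide_distrib diff_divide_distrib)
  qed
  moreover have "(\<lambda>N. (sin \<theta>)\<^sup>2 * x N + (cos \<theta>)\<^sup>2 * y N - 2 * sin \<theta> * cos \<theta> * z N)
      \<longlonglongrightarrow> (sin \<theta>)\<^sup>2 * 0 + (cos \<theta>)\<^sup>2 * 1 - 2 * sin \<theta> * cos \<theta> * 0"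
    by (intro tendsto_intros x y z)
  ultimately have "gram_ratio b E (- pi / 2) \<longlonglongrightarrow> (cos \<theta>)\<^sup>2" by simp
  then have l1: "lim (gram_ratio b E (- pi / 2)) = (cos \<theta>)\<^sup>2" by (rule limI)
  have "gram_ratio b E 0
      = (\<lambda>N. - (sin \<theta> * cos \<theta>) * x N + sin \<theta> * cos \<theta> * y N + ((cos \<theta>)\<^sup>2 - (sin \<theta>)\<^sup>2) * z N)"
  proof
    fix N
    have "(\<Sum>n=1..N. phi1 b E (- pi / 2) n * phi1 b E 0 n)
        = (\<Sum>n=1..N. (- (sin \<theta> * cos \<theta>)) * (f n)\<^sup>2 + (sin \<theta> * cos \<theta>) * (g n)\<^sup>2
            + ((cos \<theta>)\<^sup>2 - (sin \<theta>)\<^sup>2) * (f n * g n))"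
      unfolding s_eq c_eq by (rule sum.cong) (simp_all add: power2_eq_square algebra_simps)
    also have "\<dots> = (- (sin \<theta> * cos \<theta>)) * A N + (sin \<theta> * cos \<theta>) * D N + ((cos \<theta>)\<^sup>2 - (sin \<theta>)\<^sup>2) * H N"
      by (simp only: A_def D_def H_def sum.distrib sum_distrib_left)
    finally show "gram_ratio b E 0 N
        = - (sin \<theta> * cos \<theta>) * x N + sin \<theta> * cos \<theta> * y N + ((cos \<theta>)\<^sup>2 - (sin \<theta>)\<^sup>2) * z N"
      unfolding gram_ratio_def tr x_def y_def z_def by (simp add: add_divide_distrib diff_divide_distrib)
  qed
  moreover have "(\<lambda>N. - (sin \<theta> * cos \<theta>) * x N + sin \<theta> * cos \<theta> * y N + ((cos \<theta>)\<^sup>2 - (sin \<theta>)\<^sup>2) * z N)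
      \<longlonglongrightarrow> - (sin \<theta> * cos \<theta>) * 0 + sin \<theta> * cos \<theta> * 1 + ((cos \<theta>)\<^sup>2 - (sin \<theta>)\<^sup>2) * 0"
    by (intro tendsto_intros x y z)
  ultimately have "gram_ratio b E 0 \<longlonglongrightarrow> sin \<theta> * cos \<theta>" by simp
  then have l2: "lim (gram_ratio b E 0) = sin \<theta> * cos \<theta>" by (rule limI)
  show ?thesis
  proof (cases "\<theta> = - pi / 2")
    case True
    then show ?thesis unfolding limit_angle_def l1 \<theta>_def[symmetric] by simp
  next
    case False
    then have "0 < cos \<theta>" using \<theta> by (intro cos_gt_zero_pi) auto
    then have "sin \<theta> * cos \<theta> / (cos \<theta>)\<^sup>2 = tan \<theta>" by (simp add: tan_def power2_eq_square)
    then show ?thesis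
      unfolding limit_angle_def l1 l2 \<theta>_def[symmetric]
      using \<open>0 < cos \<theta>\<close> \<theta> False by (simp add: arctan_tan)
  qed
qed

lemma pred_convergent_real:
  fixes f :: "nat \<Rightarrow> 'a \<Rightarrow> real"
  assumes "\<And>n. f n \<in> borel_measurable M"
  shows "Measurable.pred M (\<lambda>x. convergent (\<lambda>n. f n x))"
  using sets_Collect_Cauchy[OF assms] unfolding Cauchy_convergent_iff pred_def .

lemma pred_asymptotically_free:
  fixes bt :: "nat \<Rightarrow> 'w \<Rightarrow> real"
  assumes \<nu>: "sets \<nu> = sets borel" and bt: "\<And>n. n \<ge> 1 \<Longrightarrow> bt n \<in> borel_measurable P"
  shows "Measurable.pred (\<nu> \<Otimes>\<^sub>M P)
    (\<lambda>x. asymptotically_free s b (fst x) (limit_angle b (fst x)) (\<lambda>n. bt n (snd x)))"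
proof -
  let ?M = "\<nu> \<Otimes>\<^sub>M P"
  have E [measurable]: "fst \<in> borel_measurable ?M"
    using measurable_fst[of \<nu> P] measurable_cong_sets[OF refl \<nu>, of ?M] by simp
  have \<theta> [measurable]: "(\<lambda>x. limit_angle b (fst x)) \<in> borel_measurable ?M"
    by (rule measurable_compose[OF E borel_measurable_limit_angle])
  have v: "(\<lambda>x. bt n (snd x)) \<in> borel_measurable ?M" if "n \<ge> 1" for n
    by (rule measurable_compose[OF measurable_snd bt[OF that]])
  have u [measurable]: "(\<lambda>x. phi1 (\<lambda>n. b n + bt n (snd x)) (fst x) (\<tau> x) n) \<in> borel_measurable ?M"
    if [measurable]: "\<tau> \<in> borel_measurable ?M" for \<tau> n
  proof (rule borel_measurable_phi1[where N = n])
    show "(\<lambda>x. b k + bt k (snd x)) \<in> borel_measurable ?M" if "1 \<le> k" for k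
      using v[OF that] by simp
  qed auto
  have f [measurable]: "(\<lambda>x. phi1 b (fst x) (\<tau> x) n) \<in> borel_measurable ?M"
    if [measurable]: "\<tau> \<in> borel_measurable ?M" for \<tau> n
    by (rule borel_measurable_phi1[where N = n and w = "\<lambda>n _. b n"]) auto
  have g [measurable]: "(\<lambda>x. phi2 b (fst x) (limit_angle b (fst x)) n) \<in> borel_measurable ?M" for n
    unfolding phi2_def by (rule f) measurable
  define G where "G \<tau> x \<longleftrightarrow>
      convergent (wronskian (phi1 (\<lambda>n. b n + bt n (snd x)) (fst x) \<tau>) (phi2 b (fst x) (limit_angle b (fst x)))) \<and>
      convergent (\<lambda>N. \<Sum>k=1..N. real k powr s * (bt k (snd x) *
        phi1 (\<lambda>n. b n + bt n (snd x)) (fst x) \<tau> k * phi1 b (fst x) (limit_angle b (fst x)) k))" for \<tau> x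
  have main: "Measurable.pred ?M (\<lambda>x. G (\<tau> x) x)" if \<tau>: "\<tau> \<in> borel_measurable ?M" for \<tau>
    unfolding G_def
  proof (intro pred_intros_logic pred_convergent_real)
    note u = u[OF \<tau>]
    show "(\<lambda>x. wronskian (phi1 (\<lambda>n. b n + bt n (snd x)) (fst x) (\<tau> x)) (phi2 b (fst x) (limit_angle b (fst x))) n)
        \<in> borel_measurable ?M" for n
      unfolding wronskian_def by (intro borel_measurable_diff borel_measurable_times u g)
    show "(\<lambda>x. \<Sum>k=1..N. real k powr s * (bt k (snd x) *
        phi1 (\<lambda>n. b n + bt n (snd x)) (fst x) (\<tau> x) k * phi1 b (fst x) (limit_angle b (fst x)) k))
        \<in> borel_measurable ?M" for N
      by (intro borel_measurable_sum borel_measurable_times borel_measurable_const u f \<theta> v) auto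
  qed
  have "Measurable.pred ?M (\<lambda>x. G (limit_angle b (fst x)) x \<and> G (limit_angle b (fst x) - pi / 2) x)"
    by (intro pred_intros_logic main borel_measurable_diff \<theta> borel_measurable_const)
  then show ?thesis
    unfolding asymptotically_free_def G_def by (simp add: conj_assoc)
qed

text \<open>
  Tonelli's theorem, with the set \<open>A\<close> enlarged to the set of all \<open>E\<close> whose section of \<open>Q\<close> has full
  measure, which is measurable as \<open>Q\<close> is.
\<close>
lemma AE_swap_of_measurable:
  fixes Q :: "'a \<Rightarrow> 'w \<Rightarrow> bool"
  assumes "sigma_finite_measure \<nu>" "sigma_finite_measure P"
    and Q: "Measurable.pred (\<nu> \<Otimes>\<^sub>M P) (\<lambda>x. Q (fst x) (snd x))"
    and A: "\<And>E. E \<in> A \<Longrightarrow> AE \<omega> in P. Q E \<omega>"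
  shows "AE \<omega> in P. AE E in \<nu>. E \<in> A \<longrightarrow> Q E \<omega>"
proof -
  interpret \<nu>: sigma_finite_measure \<nu> by fact
  interpret noise: sigma_finite_measure P by fact
  interpret pair_sigma_finite \<nu> P ..
  define Bad where "Bad = {x \<in> space (\<nu> \<Otimes>\<^sub>M P). \<not> Q (fst x) (snd x)}"
  have Bad: "Bad \<in> sets (\<nu> \<Otimes>\<^sub>M P)"
    unfolding Bad_def using Q by measurable
  define A' where "A' = {E \<in> space \<nu>. emeasure P (Pair E -` Bad) = 0}"
  have A': "A' \<in> sets \<nu>"
    unfolding A'_def using noise.measurable_emeasure_Pair[OF Bad] by measurable
  have slice: "(AE \<omega> in P. Q E \<omega>) \<longleftrightarrow> E \<in> A'" if "E \<in> space \<nu>" for E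
  proof -
    have "Pair E -` Bad \<in> sets P" using Bad by (rule sets_Pair1)
    moreover have "{\<omega> \<in> space P. \<not> Q E \<omega>} = Pair E -` Bad"
      using that by (auto simp: Bad_def space_pair_measure)
    ultimately show ?thesis using that by (simp add: AE_iff_measurable A'_def)
  qed
  have "AE E in \<nu>. AE \<omega> in P. E \<in> A' \<longrightarrow> Q E \<omega>"
  proof (rule AE_I2)
    fix E assume "E \<in> space \<nu>"
    then show "AE \<omega> in P. E \<in> A' \<longrightarrow> Q E \<omega>" using slice[of E] by (cases "E \<in> A'") auto
  qed
  moreover have "{x \<in> space (\<nu> \<Otimes>\<^sub>M P). fst x \<in> A' \<longrightarrow> Q (fst x) (snd x)} \<in> sets (\<nu> \<Otimes>\<^sub>M P)"
    using A' Q by measurable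
  ultimately have "AE \<omega> in P. AE E in \<nu>. E \<in> A' \<longrightarrow> Q E \<omega>"
    by (subst (asm) AE_commute)
  then show ?thesis
  proof eventually_elim
    case (elim \<omega>)
    then show ?case
    proof (rule AE_mp, intro AE_I2 impI)
      fix E assume "E \<in> space \<nu>" "E \<in> A' \<longrightarrow> Q E \<omega>" "E \<in> A"
      then show "Q E \<omega>" using slice A by blast
    qed
  qed
qed

text \<open>Solutions with Wronskian \<open>1\<close> have no common zero.\<close>
lemma r_weight_pos: "n \<ge> 1 \<Longrightarrow> 0 < r_weight b E q n"
proof -
  assume n: "n \<ge> 1"
  have "phi1 b E (theta b E) n \<noteq> 0 \<or> phi2 b E (theta b E) n \<noteq> 0"
    using wronskian_phi[of b E "theta b E" n] by (auto simp: wronskian_def)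
  then show ?thesis
    unfolding r_weight_def using n by (auto intro: add_pos_nonneg add_nonneg_pos)
qed

text \<open>
  As the weights are strictly positive, finiteness of the weighted series contains finiteness of every
  second moment, and the series becomes one of real numbers.
\<close>
lemma (in prob_space) AE_asymptotically_free_of_moments:
  fixes bt :: "nat \<Rightarrow> 'a \<Rightarrow> real"
  assumes ind: "indep_vars (\<lambda>_. borel) bt {1..}"
    and mean: "\<And>n. n \<ge> 1 \<Longrightarrow> expectation (bt n) = 0"
    and q: "q > 0"
    and fin: "(\<Sum>n. ennreal (r_weight b E q (Suc n)) * (\<integral>\<^sup>+\<omega>. ennreal ((bt (Suc n) \<omega>)\<^sup>2) \<partial>M)) < \<infinity>"
  shows "AE \<omega> in M. asymptotically_free (q / 2) b E (theta b E) (\<lambda>n. bt n \<omega>)"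
proof -
  have bt: "bt n \<in> borel_measurable M" if "n \<ge> 1" for n
    using ind that by (auto simp: indep_vars_def)
  have sq: "integrable M (\<lambda>\<omega>. (bt n \<omega>)\<^sup>2)" if n: "n \<ge> 1" for n
  proof (rule integrableI_nonneg)
    obtain m where m: "n = Suc m" using n by (cases n) auto
    have "ennreal (r_weight b E q n) * (\<integral>\<^sup>+\<omega>. ennreal ((bt n \<omega>)\<^sup>2) \<partial>M) < \<infinity>"
      using ennreal_suminf_lessD[OF fin, of m] m by simp
    then show "(\<integral>\<^sup>+\<omega>. ennreal ((bt n \<omega>)\<^sup>2) \<partial>M) < \<infinity>"
      using r_weight_pos[OF n, of b E q] by (auto simp: ennreal_mult_less_top)
  qed (use bt[OF n] in auto)
  have nn: "(\<integral>\<^sup>+\<omega>. ennreal ((bt (Suc n) \<omega>)\<^sup>2) \<partial>M) = ennreal (expectation (\<lambda>\<omega>. (bt (Suc n) \<omega>)\<^sup>2))" for n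
    by (rule nn_integral_eq_integral) (use sq in auto)
  have sm: "summable (\<lambda>n. r_weight b E q (Suc n) * expectation (\<lambda>\<omega>. (bt (Suc n) \<omega>)\<^sup>2))"
  proof (rule summable_suminf_not_top)
    show "0 \<le> r_weight b E q (Suc n) * expectation (\<lambda>\<omega>. (bt (Suc n) \<omega>)\<^sup>2)" for n
      using r_weight_pos[of "Suc n" b E q] by simp
    have "ennreal (r_weight b E q (Suc n) * expectation (\<lambda>\<omega>. (bt (Suc n) \<omega>)\<^sup>2))
        = ennreal (r_weight b E q (Suc n)) * (\<integral>\<^sup>+\<omega>. ennreal ((bt (Suc n) \<omega>)\<^sup>2) \<partial>M)" for n
      using r_weight_pos[of "Suc n" b E q] by (simp add: nn ennreal_mult)
    then show "(\<Sum>n. ennreal (r_weight b E q (Suc n) * expectation (\<lambda>\<omega>. (bt (Suc n) \<omega>)\<^sup>2))) \<noteq> top"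
      using fin by (simp add: less_top)
  qed
  interpret centered_noise M
    "\<lambda>n. vimage_algebra (space M) (\<lambda>\<omega>. restrict (\<lambda>i. bt i \<omega>) {1..n}) (PiM {1..n} (\<lambda>_. borel))" bt
    by (rule centered_noise_natural_filtration[OF ind mean sq])
  show ?thesis
    by (rule AE_asymptotically_free[OF q]) (use sm in \<open>simp add: r_weight_def\<close>)
qed

theorem theorem1p3:
  fixes P :: "'w measure"
    and b :: "nat \<Rightarrow> real"
    and bt :: "nat \<Rightarrow> 'w \<Rightarrow> real"
    and \<nu> :: "real measure"
    and \<alpha> :: real
  assumes "prob_space P"
    and "prob_space.indep_vars P (\<lambda>_. borel) bt {1..}"
    and "\<And>n. n \<ge> 1 \<Longrightarrow> integrable P (bt n)"
    and "\<And>n. n \<ge> 1 \<Longrightarrow> (\<integral>\<omega>. bt n \<omega> \<partial>P) = 0"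
    and "0 < \<alpha>" and "\<alpha> < 1"
    and "sets \<nu> = sets borel" and "sigma_finite_measure \<nu>"
  shows "AE \<omega> in P.
      (AE E in \<nu>. E \<in> Lambda_set P b bt \<inter> Sigma_alpha_c \<alpha> b
          \<longrightarrow> E \<in> Sigma_alpha_c \<alpha> (\<lambda>n. b n + bt n \<omega>)) \<and>
      (AE E in \<nu>. E \<in> Lambda_set P b bt \<inter> Sigma_alpha_s \<alpha> b
          \<longrightarrow> E \<in> Sigma_alpha_s \<alpha> (\<lambda>n. b n + bt n \<omega>))"
proof -
  interpret P: prob_space P by fact
  have bt: "bt n \<in> borel_measurable P" if "n \<ge> 1" for n
    using assms(3)[OF that] by auto
  define moment where "moment n = (\<integral>\<^sup>+\<omega>. ennreal ((bt n \<omega>)\<^sup>2) \<partial>P)" for n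
  define good where "good q = {E \<in> Lambda0 b. eta b E < q \<and>
      (\<Sum>n. ennreal (r_weight b E q (Suc n)) * moment (Suc n)) < \<infinity>}" for q
  \<comment> \<open>The exceptional set of \<open>\<omega>\<close> depends on the exponent, so only rational exponents are treated; every
    admissible exponent can be lowered to a rational one above \<open>\<eta>(E)\<close>.\<close>
  have rational: "AE \<omega> in P. AE E in \<nu>. E \<in> good q \<longrightarrow>
      asymptotically_free (q / 2) b E (limit_angle b E) (\<lambda>n. bt n \<omega>)" if q: "q > 0" for q :: real
  proof (rule AE_swap_of_measurable[OF assms(8) P.sigma_finite_measure_axioms])
    show "Measurable.pred (\<nu> \<Otimes>\<^sub>M P) (\<lambda>x.
        asymptotically_free (q / 2) b (fst x) (limit_angle b (fst x)) (\<lambda>n. bt n (snd x)))"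
      by (rule pred_asymptotically_free[OF assms(7) bt])
    fix E assume E: "E \<in> good q"
    then have "limit_angle b E = theta b E"
      by (intro limit_angle_eq_theta) (auto simp: good_def Lambda0_def Sigma_sc_def)
    then show "AE \<omega> in P. asymptotically_free (q / 2) b E (limit_angle b E) (\<lambda>n. bt n \<omega>)"
      using P.AE_asymptotically_free_of_moments[OF assms(2,4) q] E
      by (simp add: good_def moment_def)
  qed
  have "AE \<omega> in P. \<forall>q\<in>{q \<in> \<rat>. q > 0}. AE E in \<nu>. E \<in> good q \<longrightarrow>
      asymptotically_free (q / 2) b E (limit_angle b E) (\<lambda>n. bt n \<omega>)"
    using countable_rat by (subst AE_ball_countable) (auto intro: countable_subset rational)
  then show ?thesis
  proof eventually_elim
    case (elim \<omega>)
    then have "AE E in \<nu>. \<forall>q\<in>{q \<in> \<rat>. q > 0}. E \<in> good q \<longrightarrow>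
        asymptotically_free (q / 2) b E (limit_angle b E) (\<lambda>n. bt n \<omega>)"
      using countable_rat by (subst AE_ball_countable) (auto intro: countable_subset)
    then have "AE E in \<nu>. E \<in> Lambda_set P b bt \<longrightarrow>
        (E \<in> Sigma_alpha_s \<alpha> (\<lambda>n. b n + bt n \<omega>) \<longleftrightarrow> E \<in> Sigma_alpha_s \<alpha> b)"
    proof (rule AE_mp, intro AE_I2 impI)
      fix E
      assume free: "\<forall>q\<in>{q \<in> \<rat>. q > 0}. E \<in> good q \<longrightarrow>
          asymptotically_free (q / 2) b E (limit_angle b E) (\<lambda>n. bt n \<omega>)"
        and "E \<in> Lambda_set P b bt"
      then obtain \<eta>' where E: "E \<in> Lambda0 b" and \<eta>': "\<eta>' > 0" "\<eta>' > eta b E"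
        "(\<Sum>n. ennreal (r_weight b E \<eta>' (Suc n)) * moment (Suc n)) < \<infinity>"
        unfolding Lambda_set_def moment_def by blast
      have "max 0 (eta b E) < \<eta>'" using \<eta>' by simp
      then obtain q where q: "q \<in> \<rat>" "max 0 (eta b E) < q" "q < \<eta>'" using Rats_dense_in_real by blast
      have "(\<Sum>n. ennreal (r_weight b E q (Suc n)) * moment (Suc n))
          \<le> (\<Sum>n. ennreal (r_weight b E \<eta>' (Suc n)) * moment (Suc n))"
      proof (intro suminf_le mult_right_mono ennreal_leI)
        show "r_weight b E q (Suc n) \<le> r_weight b E \<eta>' (Suc n)" for n
          unfolding r_weight_def using q by (intro add_right_mono mult_left_mono powr_mono) auto
      qed auto
      then have "E \<in> good q" using E q \<eta>'(3) by (auto simp: good_def)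
      then have "asymptotically_free (q / 2) b E (limit_angle b E) (\<lambda>n. bt n \<omega>)" using free q by auto
      moreover have "limit_angle b E = theta b E"
        using E by (intro limit_angle_eq_theta) (auto simp: Lambda0_def Sigma_sc_def)
      ultimately show "E \<in> Sigma_alpha_s \<alpha> (\<lambda>n. b n + bt n \<omega>) \<longleftrightarrow> E \<in> Sigma_alpha_s \<alpha> b"
        using q by (intro asymptotically_free_transfer[OF E, of q]) auto
    qed
    then show ?case
      by (intro conjI; elim AE_mp; intro AE_I2) (auto simp: Sigma_alpha_c_def)
  qed
qed

end
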